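(* Assume the following. (U1) $u$ is strictly concave, increasing, continuous at zero, and $u(0)=0$. (U2) There is a constant $d>0$ with $u(a)\le d\,w(a,\theta)$ for all $\theta\in\mathcal S$, $a\in[0,\infty)$. (U3) $u$ is continuously differentiable on $(0,\infty)$. (U4) $u'_+(0)=\infty$, where $u'_+(0)$ is the right-hand derivative of $u$ at $0$. (F1) For every $z\ge 0$ and $\theta\in\mathcal S$ the function $f(\theta,\cdot,z)$ is non-decreasing, continuous and concave, and for every $y\ge 0$ and $\theta\in\mathcal S$ the function $f(\theta,y,\cdot)$ is Borel measurable. (F2) There is a constant $\alpha\in(0,1/\beta)$ with $\sup_{y\in[0,x]}\sup_{\theta'\in\mathcal S}\int_{[0,\infty)}w(f(\theta,y,z),\theta')\,\nu(dz)\le\alpha\,w(x,\theta)$ for all $\theta\in\mathcal S$, $x\in[0,\infty)$. (F3) For each $z\in[0,\infty)$, $\theta\in\mathcal S$, the function $f(\theta,\cdot,z)$ is continuously differentiable on $(0,\infty)$. (F4) $f(\theta,0,z)=0$ for all $z\ge0$ and $\theta\in\mathcal S$. (F5) For $\nu$-almost every $z$ there is $y>0$ such that $f'(\theta,y,z)>0$ for all $\theta\in\mathcal S$, where $f'(\theta,y,z):=\partial f(\theta,y,z)/\partial y$. (D1) $\displaystyle\lim_{y\to0^+}\max_{\theta\in\mathcal S}\int_{[0,\infty)}\frac{1}{\beta f'(\theta,y,z)}\,\nu(dz)<1$. (D2) There exist $\lambda_2\in(0,1)$ and $\kappa_2>0$ such that $\max_{\theta\in\mathcal S}\int_{[0,\infty)}f(\theta,y,z)\,\nu(dz)\le\lambda_2y+\kappa_2$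 for all $y\in[0,\infty)$. (D3) The transition probability matrix $p$ is irreducible. Then there exists a non-trivial stationary distribution for the Markov chain $\{(x_k,\theta_k)\}_{k\in\mathbb N}$ on $[0,\infty)\times\mathcal S$ given by $$\mathbb P(\theta_{k+1}=j\mid h_k)=\mathbb P(\theta_{k+1}=j\mid\theta_k)=p_{\theta_kj},\qquad x_{k+1}=f(\theta_k,\phi^*(x_k,\theta_k),\xi_k),$$ where $h_k$ is the history up to time $k$ and $\{\xi_k\}_{k\in\mathbb N}$ is an i.i.d. sequence with common distribution $\nu$, independent of $\{\theta_k\}_{k\in\mathbb N}$.
   Context: Data: $\mathcal S$ is a finite nonempty set (regimes); $p=(p_{\theta\theta'})_{\theta,\theta'\in\mathcal S}$ is a transition probability (stochastic) matrix; $\nu$ is a Borel probability measure on $[0,\infty)$; $\beta\in(0,1)$ is the discount factor; $\gamma>0$ is the risk-sensitivity parameter; $u:[0,\infty)\to[0,\infty)$ is the utility function; $f:\mathcal S\times[0,\infty)\times[0,\infty)\to[0,\infty)$ is the production function; $w:[0,\infty)\times\mathcal S\to[1,\infty)$ is continuous and, for each $\theta$, non-decreasing in its first variable. Function spaces: for Borel measurable $v:[0,\infty)\times\mathcal S\to\mathbb R$ let $\|v\|_w:=\sup_{x\ge0,\theta\in\mathcal S}|v(x,\theta)|/w(x,\theta)$; $\mathcal B$ is the set of Borel measurable $v:[0,\infty)\times\mathcal S\to\mathbb R$ with $\|v\|_w<\infty$ such that for each $\theta$ the function $v(\cdot,\theta)$ is non-decreasing, non-negative, continuous and concave. $\Phi$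 is the set of Borel measurable $\phi:[0,\infty)\times\mathcal S\to[0,\infty)$ with $0\le\phi(x,\theta)\le x$. Optimal policy: $V$ denotes the unique function in $\mathcal B$ satisfying $$V(x,\theta)=\sup_{y\in[0,x]}\left(u(x-y)-\frac{\beta}{\gamma}\ln\left[\sum_{\theta'\in\mathcal S}p_{\theta\theta'}\int_{[0,\infty)}e^{-\gamma V(f(\theta,y,z),\theta')}\,\nu(dz)\right]\right)$$ for all $x\in[0,\infty)$, $\theta\in\mathcal S$, and $\phi^*$ denotes the unique element of $\Phi$ such that for all $x,\theta$ the supremum is attained at $y=\phi^*(x,\theta)$. (Under (U1)-(U2), (F1)-(F2), the existence and uniqueness of $V$ and $\phi^*$ is an earlier result of the paper.) A stationary distribution is an invariant probability measure of the chain on $[0,\infty)\times\mathcal S$; it is non-trivial if it is not concentrated on zero income, i.e. on $\{0\}\times\mathcal S$. In (D1), $1/0=+\infty$. *)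

theory Defs
  imports "HOL-Probability.Probability"
begin

text \<open>The regimes are the elements of a type of class \<open>finite\<close>. A function on
  \<open>[0,\<infinity>)\<close> is a total function on \<^typ>\<open>real\<close> of which only the values on \<open>{0..}\<close> are
  constrained or used.\<close>

abbreviation halfline :: "real measure" where
  "halfline \<equiv> restrict_space borel {0..}"

abbreviation state_space :: "(real \<times> 's) measure" where
  "state_space \<equiv> halfline \<Otimes>\<^sub>M count_space UNIV"

definition stochastic_matrix :: "('s::finite \<Rightarrow> 's \<Rightarrow> real) \<Rightarrow> bool" where
  "stochastic_matrix p \<longleftrightarrow> (\<forall>i j. 0 \<le> p i j) \<and> (\<forall>i. (\<Sum>j\<in>UNIV. p i j) = 1)"

primrec nstep :: "('s::finite \<Rightarrow> 's \<Rightarrow> real) \<Rightarrow> nat \<Rightarrow> 's \<Rightarrow> 's \<Rightarrow> real" where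
  "nstep p 0 = (\<lambda>i j. if i = j then 1 else 0)"
| "nstep p (Suc n) = (\<lambda>i j. \<Sum>k\<in>UNIV. p i k * nstep p n k j)"

definition irreducible_matrix :: "('s::finite \<Rightarrow> 's \<Rightarrow> real) \<Rightarrow> bool" where
  "irreducible_matrix p \<longleftrightarrow> (\<forall>i j. \<exists>n\<ge>1. 0 < nstep p n i j)"

definition strictly_concave_on :: "real set \<Rightarrow> (real \<Rightarrow> real) \<Rightarrow> bool" where
  "strictly_concave_on A g \<longleftrightarrow> convex A \<and>
     (\<forall>x\<in>A. \<forall>y\<in>A. \<forall>t. x \<noteq> y \<and> 0 < t \<and> t < 1 \<longrightarrow>
        (1 - t) * g x + t * g y < g ((1 - t) * x + t * y))"

definition wnorm :: "(real \<Rightarrow> 's \<Rightarrow> real) \<Rightarrow> (real \<Rightarrow> 's \<Rightarrow> real) \<Rightarrow> ennreal" where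
  "wnorm w v = (SUP x\<in>{0..}. SUP \<theta>. ennreal (\<bar>v x \<theta>\<bar> / w x \<theta>))"

definition value_space :: "(real \<Rightarrow> 's::finite \<Rightarrow> real) \<Rightarrow> (real \<Rightarrow> 's \<Rightarrow> real) set" where
  "value_space w = {v. (\<lambda>(x, \<theta>). v x \<theta>) \<in> borel_measurable state_space \<and> wnorm w v < \<infinity> \<and>
     (\<forall>\<theta>. mono_on {0..} (\<lambda>x. v x \<theta>) \<and> (\<forall>x\<ge>0. 0 \<le> v x \<theta>) \<and>
          continuous_on {0..} (\<lambda>x. v x \<theta>) \<and> concave_on {0..} (\<lambda>x. v x \<theta>))}"

definition policy_space :: "(real \<Rightarrow> 's::finite \<Rightarrow> real) set" where
  "policy_space = {\<phi>. (\<lambda>(x, \<theta>). \<phi> x \<theta>) \<in> borel_measurable state_space \<and>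
     (\<forall>x\<ge>0. \<forall>\<theta>. 0 \<le> \<phi> x \<theta> \<and> \<phi> x \<theta> \<le> x)}"

definition bellman_objective ::
  "('s::finite \<Rightarrow> 's \<Rightarrow> real) \<Rightarrow> real measure \<Rightarrow> real \<Rightarrow> real \<Rightarrow> (real \<Rightarrow> real) \<Rightarrow>
   ('s \<Rightarrow> real \<Rightarrow> real \<Rightarrow> real) \<Rightarrow> (real \<Rightarrow> 's \<Rightarrow> real) \<Rightarrow> real \<Rightarrow> 's \<Rightarrow> real \<Rightarrow> real" where
  "bellman_objective p \<nu> \<beta> \<gamma> u f v x \<theta> y =
     u (x - y) - \<beta> / \<gamma> *
       ln (\<Sum>\<theta>'\<in>UNIV. p \<theta> \<theta>' * (\<integral>z. exp (- \<gamma> * v (f \<theta> y z) \<theta>') \<partial>\<nu>))"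

definition is_value_function ::
  "('s::finite \<Rightarrow> 's \<Rightarrow> real) \<Rightarrow> real measure \<Rightarrow> real \<Rightarrow> real \<Rightarrow> (real \<Rightarrow> real) \<Rightarrow>
   ('s \<Rightarrow> real \<Rightarrow> real \<Rightarrow> real) \<Rightarrow> (real \<Rightarrow> 's \<Rightarrow> real) \<Rightarrow> (real \<Rightarrow> 's \<Rightarrow> real) \<Rightarrow> bool" where
  "is_value_function p \<nu> \<beta> \<gamma> u f w V \<longleftrightarrow> V \<in> value_space w \<and>
     (\<forall>x\<ge>0. \<forall>\<theta>. V x \<theta> = (SUP y\<in>{0..x}. bellman_objective p \<nu> \<beta> \<gamma> u f V x \<theta> y))"

definition is_optimal_policy ::
  "('s::finite \<Rightarrow> 's \<Rightarrow> real) \<Rightarrow> real measure \<Rightarrow> real \<Rightarrow> real \<Rightarrow> (real \<Rightarrow> real) \<Rightarrow>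
   ('s \<Rightarrow> real \<Rightarrow> real \<Rightarrow> real) \<Rightarrow> (real \<Rightarrow> 's \<Rightarrow> real) \<Rightarrow> (real \<Rightarrow> 's \<Rightarrow> real) \<Rightarrow> bool" where
  "is_optimal_policy p \<nu> \<beta> \<gamma> u f V \<phi> \<longleftrightarrow> \<phi> \<in> policy_space \<and>
     (\<forall>x\<ge>0. \<forall>\<theta>. bellman_objective p \<nu> \<beta> \<gamma> u f V x \<theta> (\<phi> x \<theta>) =
        (SUP y\<in>{0..x}. bellman_objective p \<nu> \<beta> \<gamma> u f V x \<theta> y))"

text \<open>One-step transition law of the chain: given the history up to time \<open>k\<close> with current
  state \<open>(x, \<theta>)\<close>, the shock \<open>\<xi>\<^sub>k \<sim> \<nu>\<close> and the next regime \<open>\<theta>\<^sub>k\<^sub>+\<^sub>1 \<sim> p \<theta>\<close> are independent,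
  and the next state is \<open>(f \<theta> (\<phi> x \<theta>) \<xi>\<^sub>k, \<theta>\<^sub>k\<^sub>+\<^sub>1)\<close>.\<close>

definition income_kernel ::
  "('s::finite \<Rightarrow> 's \<Rightarrow> real) \<Rightarrow> real measure \<Rightarrow> ('s \<Rightarrow> real \<Rightarrow> real \<Rightarrow> real) \<Rightarrow>
   (real \<Rightarrow> 's \<Rightarrow> real) \<Rightarrow> real \<times> 's \<Rightarrow> (real \<times> 's) measure" where
  "income_kernel p \<nu> f \<phi> = (\<lambda>(x, \<theta>).
     distr (\<nu> \<Otimes>\<^sub>M point_measure UNIV (\<lambda>j. ennreal (p \<theta> j))) state_space
       (\<lambda>(z, j). (f \<theta> (\<phi> x \<theta>) z, j)))"

definition stationary_distribution ::
  "(real \<times> 's \<Rightarrow> (real \<times> 's) measure) \<Rightarrow> (real \<times> 's) measure \<Rightarrow> bool" where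
  "stationary_distribution K \<mu> \<longleftrightarrow> prob_space \<mu> \<and> sets \<mu> = sets state_space \<and>
     (\<forall>A\<in>sets state_space. (\<integral>\<^sup>+ s. emeasure (K s) A \<partial>\<mu>) = emeasure \<mu> A)"

definition nontrivial_distribution :: "(real \<times> 's) measure \<Rightarrow> bool" where
  "nontrivial_distribution \<mu> \<longleftrightarrow> measure \<mu> ({0} \<times> UNIV) \<noteq> 1"

lemma emeasure_income_kernel:
  fixes p :: "'s::finite \<Rightarrow> 's \<Rightarrow> real"
  assumes "prob_space \<nu>" "sets \<nu> = sets halfline"
    and g: "f \<theta> (\<phi> x \<theta>) \<in> \<nu> \<rightarrow>\<^sub>M halfline" and A: "A \<in> sets halfline"
  shows "emeasure (income_kernel p \<nu> f \<phi> (x, \<theta>)) (A \<times> {j}) =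
    emeasure \<nu> {z \<in> {0..}. f \<theta> (\<phi> x \<theta>) z \<in> A} * ennreal (p \<theta> j)"
proof -
  interpret prob_space \<nu> by fact
  let ?P = "point_measure UNIV (\<lambda>j. ennreal (p \<theta> j))"
  interpret P: finite_measure ?P
    by (rule finite_measureI)
      (simp add: space_point_measure emeasure_point_measure_finite)
  have spn: "space \<nu> = {0..}"
    using assms(2) by (simp add: sets_eq_imp_space_eq[OF assms(2)] space_restrict_space)
  have m: "(\<lambda>(z, j). (f \<theta> (\<phi> x \<theta>) z, j)) \<in> \<nu> \<Otimes>\<^sub>M ?P \<rightarrow>\<^sub>M state_space"
  proof -
    have "snd \<in> \<nu> \<Otimes>\<^sub>M ?P \<rightarrow>\<^sub>M count_space UNIV"
      using measurable_snd[of \<nu> ?P] by (simp add: measurable_def sets_point_measure space_point_measure)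
    moreover have "(\<lambda>q. f \<theta> (\<phi> x \<theta>) (fst q)) \<in> \<nu> \<Otimes>\<^sub>M ?P \<rightarrow>\<^sub>M halfline"
      using measurable_compose[OF measurable_fst g] .
    ultimately show ?thesis
      by (simp add: split_beta measurable_Pair)
  qed
  have B: "{z \<in> {0..}. f \<theta> (\<phi> x \<theta>) z \<in> A} \<in> sets \<nu>"
    using measurable_sets[OF g A] by (simp add: vimage_def Int_def spn conj_commute)
  have "emeasure (income_kernel p \<nu> f \<phi> (x, \<theta>)) (A \<times> {j}) =
     emeasure (\<nu> \<Otimes>\<^sub>M ?P) ((\<lambda>(z, j). (f \<theta> (\<phi> x \<theta>) z, j)) -` (A \<times> {j}) \<inter> space (\<nu> \<Otimes>\<^sub>M ?P))"
    unfolding income_kernel_def prod.case using A by (intro emeasure_distr[OF m] pair_measureI) auto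
  also have "(\<lambda>(z, j). (f \<theta> (\<phi> x \<theta>) z, j)) -` (A \<times> {j}) \<inter> space (\<nu> \<Otimes>\<^sub>M ?P) =
     {z \<in> {0..}. f \<theta> (\<phi> x \<theta>) z \<in> A} \<times> {j}"
    by (auto simp: space_pair_measure space_point_measure spn)
  also have "emeasure (\<nu> \<Otimes>\<^sub>M ?P) \<dots> = emeasure \<nu> {z \<in> {0..}. f \<theta> (\<phi> x \<theta>) z \<in> A} * emeasure ?P {j}"
    using B by (intro P.emeasure_pair_measure_Times) (auto simp: sets_point_measure)
  also have "emeasure ?P {j} = ennreal (p \<theta> j)"
    by (subst emeasure_point_measure_finite) auto
  finally show ?thesis .
qed

end

theory Submission
  imports Defs
begin

text \<open>
  Since \<open>V\<close> is concave, the envelope argument gives \<open>V' x \<theta> = u' (x - \<phi> x \<theta>)\<close>, whence consumption is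
  monotone in \<open>x\<close>; investment is monotone by increasing differences, so \<open>\<phi>\<close> is 1-Lipschitz and the chain is Feller. Perturbing the
  optimal investment yields the Euler inequality
  \<open>\<beta> E[exp (- \<gamma> V(x', \<theta>')) V'(x', \<theta>') f'(\<theta>, y, z)] \<le> V'(x, \<theta>)\<close>, and Cauchy--Schwarz with (D1) turns it
  into a geometric drift towards the interior, near zero income, for
  \<open>W = sqrt (exp (- \<gamma> V) V')\<close>, which blows up at zero. Together with (D2) the function
  \<open>W(x, \<theta>) + x\<close> is a Lyapunov function with compact sublevel sets in \<open>(0,\<infinity>) \<times> S\<close>, and the Krylov--Bogoliubov
  argument gives a stationary distribution without mass at zero. Limits of the Cesaro averages are taken
  on the real line, into which \<open>[0,\<infinity>) \<times> S\<close> is embedded, so that Helly's selection theorem applies.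
\<close>

section \<open>Stationary measures from drift conditions on the half-line\<close>

text \<open>By \<open>F4\<close> the set of zero-income states is absorbing, so compactness of the
  closed state space alone promises no more than a trivial invariant law. Everything hinges on a
  Lyapunov function that is infinite at zero income and still contracts in expectation nearby. The
  slope V' is the natural candidate, but the Euler inequality bounds only its product with the
  marginal product f', while \<open>D1\<close> bounds the reciprocal 1 / (\<beta> f'). The exponent
  1/2 is the one at which Cauchy-Schwarz separates the two: with m = exp (- \<gamma> V) V' and some
  r < 1, E[sqrt m'] \<le> sqrt (E[m' \<beta> f'] E[1 / (\<beta> f')]) \<le> sqrt (r V'), where m' is
  m at the next state. The last term is sqrt (r exp (\<gamma> V)) W, and V tends to 0 at zero
  income, so the strictness of \<open>D1\<close> absorbs the exponential. Slopes are suprema of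
  difference quotients with values in \<open>ennreal\<close>; they pass through integrals by
  monotone rather than dominated convergence.\<close>

text \<open>Regime number \<open>i\<close> occupies the interval \<open>[2 i, 2 i + 1)\<close>; the decoder is junk off these intervals.\<close>

definition line_code :: "real \<times> 's::finite \<Rightarrow> real" where
  "line_code s = 2 * real (to_nat (snd s)) + fst s / (1 + fst s)"

definition line_decode :: "real \<Rightarrow> real \<times> 's::finite" where
  "line_decode t = (let r = t - 2 * of_int \<lfloor>t / 2\<rfloor> in
     (if r < 1 then r / (1 - r) else 0, from_nat (nat \<lfloor>t / 2\<rfloor>)))"

lemma line_decode_eq:
  fixes i :: "'s::finite"
  assumes "2 * real (to_nat i) \<le> t" "t < 2 * real (to_nat i) + 1"
  shows "line_decode t = ((t - 2 * real (to_nat i)) / (1 - (t - 2 * real (to_nat i))), i)"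
proof -
  have "\<lfloor>t / 2\<rfloor> = int (to_nat i)"
    using assms by (intro floor_unique) auto
  with assms show ?thesis
    by (simp add: line_decode_def Let_def)
qed

lemma line_decode_code:
  assumes "0 \<le> fst s"
  shows "line_decode (line_code s) = s"
proof -
  obtain x i where s: "s = (x, i)" by force
  with assms have x: "0 \<le> x" by simp
  have "0 \<le> x / (1 + x)" "x / (1 + x) < 1"
    using x by (auto simp: field_simps)
  then have "line_decode (line_code s) = ((x / (1 + x)) / (1 - x / (1 + x)), i)"
    by (subst line_decode_eq[of i]) (auto simp: s line_code_def)
  also have "(x / (1 + x)) / (1 - x / (1 + x)) = x"
    using x by (simp add: field_simps)
  finally show ?thesis by (simp add: s)
qed

lemma space_state_space: "space state_space = {0..} \<times> UNIV"
  by (simp add: space_pair_measure space_restrict_space)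

lemma measurable_fst_state_space: "fst \<in> borel_measurable state_space"
  by (rule measurable_compose[OF measurable_fst]) (auto intro: measurable_restrict_space1)

lemma measurable_line_code: "line_code \<in> borel_measurable (state_space :: (real \<times> 's::finite) measure)"
proof -
  note measurable_fst_state_space[measurable]
  have [measurable]: "(\<lambda>s::real \<times> 's. real (to_nat (snd s))) \<in> borel_measurable state_space"
    by (rule measurable_compose[OF measurable_snd]) auto
  show ?thesis unfolding line_code_def by measurable
qed

lemma measurable_line_decode:
  "line_decode \<in> borel \<rightarrow>\<^sub>M (state_space :: (real \<times> 's::finite) measure)"
proof -
  have 1: "(\<lambda>t::real. let r = t - 2 * of_int \<lfloor>t / 2\<rfloor> in if r < 1 then r / (1 - r) else 0)
    \<in> borel \<rightarrow>\<^sub>M halfline"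
  proof (rule measurable_restrict_space2)
    show "(\<lambda>t::real. let r = t - 2 * of_int \<lfloor>t / 2\<rfloor> in if r < 1 then r / (1 - r) else 0)
      \<in> space borel \<rightarrow> {0..}"
    proof safe
      fix t :: real
      have "2 * of_int \<lfloor>t / 2\<rfloor> \<le> t" by linarith
      then show "0 \<le> (let r = t - 2 * of_int \<lfloor>t / 2\<rfloor> in if r < 1 then r / (1 - r) else 0)"
        by (simp add: Let_def)
    qed
    show "(\<lambda>t::real. let r = t - 2 * of_int \<lfloor>t / 2\<rfloor> in if r < 1 then r / (1 - r) else 0)
      \<in> borel_measurable borel"
      unfolding Let_def by measurable
  qed
  have 2: "(\<lambda>t::real. from_nat (nat \<lfloor>t / 2\<rfloor>) :: 's) \<in> borel \<rightarrow>\<^sub>M count_space UNIV"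
    by measurable
  show ?thesis
    unfolding line_decode_def Let_def
    using measurable_Pair[OF 1 2] by (simp add: Let_def)
qed

text \<open>Inside the open interval the decoder is the continuous bijection
  \<open>r / (1 - r)\<close> onto the positive incomes. Both ends are excluded: at the left one the
  income is 0, where \<open>g\<close> need not be continuous, and towards the right one it tends to
  infinity.\<close>

lemma isCont_comp_line_decode:
  fixes i :: "'s::finite" and g :: "real \<times> 's \<Rightarrow> real"
  assumes g: "continuous_on {0<..} (\<lambda>x. g (x, i))"
    and t: "2 * real (to_nat i) < t" "t < 2 * real (to_nat i) + 1"
  shows "isCont (\<lambda>t. g (line_decode t)) t"
proof -
  let ?r = "\<lambda>t. (t - 2 * real (to_nat i)) / (1 - (t - 2 * real (to_nat i)))"
  have "\<forall>\<^sub>F t in nhds t. t \<in> {2 * real (to_nat i)<..<2 * real (to_nat i) + 1}"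
    using t by (intro eventually_nhds_in_open) auto
  then have ev: "\<forall>\<^sub>F t in nhds t. g (line_decode t) = g (?r t, i)"
    by eventually_elim (simp add: line_decode_eq[of i])
  have "isCont (\<lambda>x. g (x, i)) (?r t)"
    using g t by (auto simp: continuous_on_eq_continuous_at)
  moreover have "isCont ?r t"
    using t by (intro continuous_intros) auto
  ultimately have "isCont (\<lambda>t. g (?r t, i)) t"
    using isCont_o2[of t ?r "\<lambda>x. g (x, i)"] by simp
  then show ?thesis
    using isCont_cong[OF ev] by simp
qed

text \<open>\<open>line_decode\<close> inverts \<open>line_code\<close> on nonnegative incomes, so
  passing to the line loses nothing: laws are recovered and expectations computed there, where weak
  convergence of real distributions is at hand.\<close>

lemma coded_distribution:
  fixes M :: "(real \<times> 's::finite) measure"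
  assumes "M \<in> space (prob_algebra state_space)"
  shows "real_distribution (distr M borel line_code)"
    and "distr (distr M borel line_code) state_space line_decode = M"
    and "\<And>g :: real \<times> 's \<Rightarrow> real. g \<in> borel_measurable state_space \<Longrightarrow>
      integral\<^sup>L (distr M borel line_code) (\<lambda>t. g (line_decode t)) = integral\<^sup>L M g"
proof -
  have M: "sets M = sets state_space" "prob_space M"
    using assms by (auto simp: space_prob_algebra)
  interpret prob_space M by fact
  have sp: "space M = {0..} \<times> UNIV"
    using sets_eq_imp_space_eq[OF M(1)] by (simp add: space_state_space)
  have c: "line_code \<in> M \<rightarrow>\<^sub>M borel"
    using measurable_line_code measurable_cong_sets[OF M(1) refl] by blast
  show "real_distribution (distr M borel line_code)"
    using c by simp
  have "distr (distr M borel line_code) state_space line_decode = distr M state_space (line_decode \<circ> line_code)"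
    using c measurable_line_decode by (rule distr_distr[rotated])
  also have "\<dots> = distr M state_space (\<lambda>x. x)"
    by (intro distr_cong) (auto simp: sp line_decode_code)
  also have "\<dots> = M"
    using M(1) by (simp add: distr_id2)
  finally show "distr (distr M borel line_code) state_space line_decode = M" .
  fix g :: "real \<times> 's \<Rightarrow> real" assume g: "g \<in> borel_measurable state_space"
  have "integral\<^sup>L (distr M borel line_code) (\<lambda>t. g (line_decode t)) = (\<integral>s. g (line_decode (line_code s)) \<partial>M)"
    using measurable_compose[OF measurable_line_decode g] c by (intro integral_distr)
  also have "\<dots> = integral\<^sup>L M g"
    by (intro Bochner_Integration.integral_cong) (auto simp: sp line_decode_code)
  finally show "integral\<^sup>L (distr M borel line_code) (\<lambda>t. g (line_decode t)) = integral\<^sup>L M g" .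
qed

lemma line_code_bounds:
  assumes "0 \<le> fst s"
  shows "0 \<le> line_code s" "line_code (s :: real \<times> 's::finite) \<le> 2 * real (Max (range (to_nat :: 's \<Rightarrow> nat))) + 1"
proof -
  have "to_nat (snd s) \<le> Max (range (to_nat :: 's \<Rightarrow> nat))" by simp
  moreover have "0 \<le> fst s / (1 + fst s)" "fst s / (1 + fst s) \<le> 1"
    using assms by (auto simp: field_simps)
  ultimately show "0 \<le> line_code s" "line_code s \<le> 2 * real (Max (range (to_nat :: 's \<Rightarrow> nat))) + 1"
    by (auto simp: line_code_def intro!: add_mono)
qed

text \<open>All codes lie in one bounded interval, so tightness costs nothing. The price is that
  mass may escape to the code of income 0 or of infinite income;
  \<open>null_outside_code_range\<close> rules this out by means of the Lyapunov function.\<close>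

lemma tight_coded:
  fixes M :: "nat \<Rightarrow> (real \<times> 's::finite) measure"
  assumes "\<And>n. M n \<in> space (prob_algebra state_space)"
  shows "tight (\<lambda>n. distr (M n) borel line_code)"
proof -
  define N where "N = 2 * real (Max (range (to_nat :: 's \<Rightarrow> nat))) + 1"
  \<comment> \<open>The intervals in \<open>tight\<close> are open on the left, so the left end has
    to lie strictly below 0, the lower bound of all codes.\<close>
  have 1: "measure (distr (M n) borel line_code) {-1<..N} = 1" for n
  proof -
    have M: "sets (M n) = sets state_space" "prob_space (M n)"
      using assms[of n] by (auto simp: space_prob_algebra)
    interpret prob_space "M n" by fact
    have sp: "space (M n) = {0..} \<times> UNIV"
      using sets_eq_imp_space_eq[OF M(1)] by (simp add: space_state_space)
    have c: "line_code \<in> M n \<rightarrow>\<^sub>M borel"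
      using measurable_line_code measurable_cong_sets[OF M(1) refl] by blast
    have "-1 < line_code s \<and> line_code s \<le> N" if "s \<in> space (M n)" for s
      using line_code_bounds[of s] that by (auto simp: sp N_def)
    then have "line_code -` {-1<..N} \<inter> space (M n) = space (M n)"
      by auto
    then show ?thesis
      using c by (subst measure_distr) (auto simp: prob_space)
  qed
  have "-1 < N" by (simp add: N_def)
  then show ?thesis
    unfolding tight_def using coded_distribution(1)[OF assms] 1
    by (intro conjI allI impI exI[of _ "-1"] exI[of _ N]) auto
qed

text \<open>The cosine and sine of \<open>t * line_code s\<close> are bounded continuous test
  functions. They give the characteristic function of the coded law, and Levy's uniqueness theorem
  applies.\<close>

lemma measure_eqI_continuous:
  fixes M N :: "(real \<times> 's::finite) measure"
  assumes M: "M \<in> space (prob_algebra state_space)" and N: "N \<in> space (prob_algebra state_space)"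
    and eq: "\<And>g :: real \<times> 's \<Rightarrow> real. g \<in> borel_measurable state_space \<Longrightarrow> (\<And>s. \<bar>g s\<bar> \<le> 1) \<Longrightarrow>
      (\<And>i. continuous_on {0..} (\<lambda>x. g (x, i))) \<Longrightarrow> integral\<^sup>L M g = integral\<^sup>L N g"
  shows "M = N"
proof -
  let ?c = "line_code :: real \<times> 's \<Rightarrow> real"
  have cont: "continuous_on {0..} (\<lambda>x. h (t * ?c (x, i)))" if "continuous_on UNIV h" for h :: "real \<Rightarrow> real" and t i
    unfolding line_code_def fst_conv snd_conv
    by (rule continuous_on_compose2[OF that]) (auto intro!: continuous_intros)
  have meas: "(\<lambda>s. h (t * ?c s)) \<in> borel_measurable state_space" if "continuous_on UNIV h" for h :: "real \<Rightarrow> real" and t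
    using measurable_line_code borel_measurable_continuous_onI[OF that] by measurable
  have ch: "char (distr P borel ?c) t = (\<integral>s. cos (t * ?c s) \<partial>P) + \<i> * (\<integral>s. sin (t * ?c s) \<partial>P)"
    if P: "P \<in> space (prob_algebra state_space)" for P t
  proof -
    have sP: "sets P = sets state_space" "prob_space P"
      using P by (auto simp: space_prob_algebra)
    interpret prob_space P by fact
    have c[measurable]: "?c \<in> P \<rightarrow>\<^sub>M borel"
      using measurable_line_code measurable_cong_sets[OF sP(1) refl] by blast
    have i: "integrable P (\<lambda>s. cos (t * ?c s))" "integrable P (\<lambda>s. sin (t * ?c s))"
      by (auto intro!: integrable_const_bound[of _ 1])
    have "char (distr P borel ?c) t = (\<integral>s. iexp (t * ?c s) \<partial>P)"
      unfolding char_def by (subst integral_distr) auto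
    also have "\<dots> = (\<integral>s. complex_of_real (cos (t * ?c s)) + \<i> * complex_of_real (sin (t * ?c s)) \<partial>P)"
      by (intro Bochner_Integration.integral_cong refl)
        (simp del: of_real_mult add: complex_eq_iff flip: cis_conv_exp)
    also have "\<dots> = (\<integral>s. cos (t * ?c s) \<partial>P) + \<i> * (\<integral>s. sin (t * ?c s) \<partial>P)"
      using i by (subst Bochner_Integration.integral_add)
        (auto simp del: of_real_mult intro!: integrable_of_real integrable_mult_right)
    finally show ?thesis .
  qed
  have "char (distr M borel ?c) = char (distr N borel ?c)"
  proof
    fix t
    have "(\<integral>s. cos (t * ?c s) \<partial>M) = (\<integral>s. cos (t * ?c s) \<partial>N)"
         "(\<integral>s. sin (t * ?c s) \<partial>M) = (\<integral>s. sin (t * ?c s) \<partial>N)"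
      by (auto intro!: eq meas cont continuous_intros)
    then show "char (distr M borel ?c) t = char (distr N borel ?c) t"
      by (simp add: ch[OF M] ch[OF N])
  qed
  then have "distr M borel ?c = distr N borel ?c"
    by (intro Levy_uniqueness coded_distribution(1) M N)
  then show ?thesis
    using coded_distribution(2)[OF M] coded_distribution(2)[OF N] by metis
qed

section \<open>Laws of the chain and their Cesaro averages\<close>

primrec chain_law :: "('a \<Rightarrow> 'a measure) \<Rightarrow> 'a measure \<Rightarrow> nat \<Rightarrow> 'a measure" where
  "chain_law K M 0 = M"
| "chain_law K M (Suc k) = chain_law K M k \<bind> K"

text \<open>The law of the chain at a time drawn uniformly from \<open>{..n}\<close>. As a bind, it
  is a probability measure by the same rules as a single step of the chain.\<close>

definition cesaro_law :: "('a \<Rightarrow> 'a measure) \<Rightarrow> 'a measure \<Rightarrow> nat \<Rightarrow> 'a measure" where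
  "cesaro_law K M n = measure_pmf (pmf_of_set {..n}) \<bind> chain_law K M"

lemma chain_law_in_space:
  assumes "K \<in> S \<rightarrow>\<^sub>M prob_algebra S" "M \<in> space (prob_algebra S)"
  shows "chain_law K M k \<in> space (prob_algebra S)"
proof (induction k)
  case (Suc k)
  then show ?case
    using prob_space_bind'[OF Suc assms(1)] sets_bind'[OF Suc assms(1)]
    by (simp add: space_prob_algebra)
qed (use assms in simp)

lemma chain_law_measurable:
  assumes "K \<in> S \<rightarrow>\<^sub>M prob_algebra S" "M \<in> space (prob_algebra S)"
  shows "chain_law K M \<in> measure_pmf p \<rightarrow>\<^sub>M prob_algebra S"
  using chain_law_in_space[OF assms] by auto

lemma cesaro_law_in_space:
  assumes "K \<in> S \<rightarrow>\<^sub>M prob_algebra S" "M \<in> space (prob_algebra S)"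
  shows "cesaro_law K M n \<in> space (prob_algebra S)"
proof -
  have 1: "measure_pmf (pmf_of_set {..n}) \<in> space (prob_algebra (measure_pmf (pmf_of_set {..n})))"
    by (simp add: space_prob_algebra prob_space_measure_pmf)
  show ?thesis
    using prob_space_bind'[OF 1 chain_law_measurable[OF assms]] sets_bind'[OF 1 chain_law_measurable[OF assms]]
    by (simp add: cesaro_law_def space_prob_algebra)
qed

lemma integral_bind_prob_algebra:
  fixes g :: "'a \<Rightarrow> real"
  assumes M: "M \<in> space (prob_algebra S)" and K: "K \<in> S \<rightarrow>\<^sub>M prob_algebra R"
    and g: "g \<in> borel_measurable R" "\<And>x. \<bar>g x\<bar> \<le> B"
  shows "integral\<^sup>L (M \<bind> K) g = (\<integral>x. integral\<^sup>L (K x) g \<partial>M)"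
proof (rule integral_bind[where B'=1, OF g(1)])
  have sM: "sets M = sets S" "prob_space M" using M by (auto simp: space_prob_algebra)
  show "K \<in> M \<rightarrow>\<^sub>M subprob_algebra R"
    using measurable_prob_algebraD[OF K] measurable_cong_sets[OF sM(1) refl] by blast
  show "finite_measure M" using sM(2) by (simp add: prob_space_def)
  show "AE x in M. emeasure (K x) (space (K x)) \<le> ennreal 1"
    using measurable_space[OF K] sets_eq_imp_space_eq[OF sM(1)]
    by (auto simp: space_prob_algebra intro!: prob_space.emeasure_le_1)
qed (use g in auto)

lemma nn_integral_cesaro_law:
  assumes "K \<in> S \<rightarrow>\<^sub>M prob_algebra S" "M \<in> space (prob_algebra S)" "g \<in> borel_measurable S"
  shows "integral\<^sup>N (cesaro_law K M n) g = (\<Sum>k\<le>n. integral\<^sup>N (chain_law K M k) g) / ennreal (real (Suc n))"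
  unfolding cesaro_law_def
  using nn_integral_bind[OF assms(3) measurable_prob_algebraD[OF chain_law_measurable[OF assms(1,2)]]]
  by (simp add: nn_integral_pmf_of_set ennreal_of_nat_eq_real_of_nat)

lemma integral_cesaro_law:
  fixes g :: "'a \<Rightarrow> real"
  assumes "K \<in> S \<rightarrow>\<^sub>M prob_algebra S" "M \<in> space (prob_algebra S)"
    and "g \<in> borel_measurable S" "\<And>x. \<bar>g x\<bar> \<le> B"
  shows "integral\<^sup>L (cesaro_law K M n) g = (\<Sum>k\<le>n. integral\<^sup>L (chain_law K M k) g) / real (Suc n)"
  unfolding cesaro_law_def
  by (subst integral_bind_prob_algebra[OF _ chain_law_measurable[OF assms(1,2)] assms(3,4)])
     (auto simp: space_prob_algebra prob_space_measure_pmf integral_pmf_of_set)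

lemma abs_integral_le:
  fixes g :: "'a \<Rightarrow> real"
  assumes "M \<in> space (prob_algebra S)" "g \<in> borel_measurable S" "\<And>x. \<bar>g x\<bar> \<le> B"
  shows "\<bar>integral\<^sup>L M g\<bar> \<le> B"
proof -
  have sM: "sets M = sets S" "prob_space M" using assms(1) by (auto simp: space_prob_algebra)
  interpret prob_space M by fact
  have "g \<in> borel_measurable M"
    using assms(2) measurable_cong_sets[OF sM(1) refl] by blast
  then have "integrable M g"
    using assms(3) by (intro integrable_const_bound[of _ B]) auto
  have "\<bar>integral\<^sup>L M g\<bar> \<le> (\<integral>x. \<bar>g x\<bar> \<partial>M)"
    by (rule integral_abs_bound)
  also have "\<dots> \<le> (\<integral>x. B \<partial>M)"
    using assms(3) \<open>integrable M g\<close> by (intro integral_mono) auto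
  also have "\<dots> = B" by (simp add: prob_space)
  finally show ?thesis .
qed

text \<open>One more step of the kernel shifts time by one, so the difference telescopes to the last
  minus the first expectation, divided by \<open>n + 1\<close>.\<close>

lemma cesaro_law_asymp_invariant:
  fixes g :: "'a \<Rightarrow> real"
  assumes K: "K \<in> S \<rightarrow>\<^sub>M prob_algebra S" and M: "M \<in> space (prob_algebra S)"
    and g: "g \<in> borel_measurable S" "\<And>x. \<bar>g x\<bar> \<le> B"
  shows "(\<lambda>n. integral\<^sup>L (cesaro_law K M n) (\<lambda>x. indicator (space S) x * integral\<^sup>L (K x) g)
            - integral\<^sup>L (cesaro_law K M n) g) \<longlonglongrightarrow> 0"
proof (rule Lim_null_comparison[OF always_eventually])
  let ?a = "\<lambda>k. integral\<^sup>L (chain_law K M k) g"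
  \<comment> \<open>\<open>K\<close> is unconstrained outside the space of \<open>S\<close>; the
    indicator makes the integrand bounded everywhere, and the laws of the chain do not see
    it.\<close>
  let ?g = "\<lambda>x. indicator (space S) x * integral\<^sup>L (K x) g"
  note cl = chain_law_in_space[OF K M]
  have B: "0 \<le> B" using g(2)[of undefined] by linarith
  have m: "?g \<in> borel_measurable S"
    using measurable_compose[OF measurable_prob_algebraD[OF K] integral_measurable_subprob_algebra[OF g(1)]]
    by measurable
  have b: "\<bar>?g x\<bar> \<le> B" for x
    using abs_integral_le[OF measurable_space[OF K] g, of x] B by (auto simp: indicator_def)
  have step: "integral\<^sup>L (chain_law K M k) ?g = ?a (Suc k)" for k
  proof -
    have "sets (chain_law K M k) = sets S" using cl[of k] by (simp add: space_prob_algebra)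
    note sp = sets_eq_imp_space_eq[OF this]
    have "integral\<^sup>L (chain_law K M k) ?g = (\<integral>x. integral\<^sup>L (K x) g \<partial>chain_law K M k)"
      by (intro Bochner_Integration.integral_cong) (auto simp: sp)
    then show ?thesis
      using integral_bind_prob_algebra[OF cl K g] by simp
  qed
  show "\<forall>n. norm (integral\<^sup>L (cesaro_law K M n) ?g - integral\<^sup>L (cesaro_law K M n) g) \<le> 2 * B / real (Suc n)"
  proof
    fix n
    have "integral\<^sup>L (cesaro_law K M n) ?g - integral\<^sup>L (cesaro_law K M n) g =
      (\<Sum>k\<le>n. ?a (Suc k) - ?a k) / real (Suc n)"
      unfolding integral_cesaro_law[OF K M g] integral_cesaro_law[OF K M m b] step
      by (simp add: sum_subtractf diff_divide_distrib)
    also have "(\<Sum>k\<le>n. ?a (Suc k) - ?a k) = ?a (Suc n) - ?a 0"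
        by (induction n) simp_all
    finally show "norm (integral\<^sup>L (cesaro_law K M n) ?g - integral\<^sup>L (cesaro_law K M n) g) \<le> 2 * B / real (Suc n)"
      using abs_integral_le[OF cl g, of "Suc n"] abs_integral_le[OF cl g, of 0]
      by (auto intro!: divide_right_mono)
  qed
  show "(\<lambda>n. 2 * B / real (Suc n)) \<longlonglongrightarrow> 0"
    by real_asymp
qed

lemma nn_integral_cesaro_law_drift:
  assumes K: "K \<in> S \<rightarrow>\<^sub>M prob_algebra S" and M: "M \<in> space (prob_algebra S)"
    and L: "L \<in> borel_measurable S" "integral\<^sup>N M L < \<infinity>"
    and drift: "\<And>s. s \<in> space S \<Longrightarrow> integral\<^sup>N (K s) L \<le> ennreal l * L s + ennreal c"
    and l: "0 \<le> l" "l < 1" "0 \<le> c"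
  obtains C :: real where "0 \<le> C" "\<And>n. integral\<^sup>N (cesaro_law K M n) L \<le> ennreal C"
proof -
  note cl = chain_law_in_space[OF K M]
  obtain a where a: "integral\<^sup>N M L = ennreal a" "0 \<le> a"
    using L(2) by (cases "integral\<^sup>N M L") auto
  \<comment> \<open>The fixed point \<open>c / (1 - l)\<close> of the map taking t to l t + c,
    raised by the initial value \<open>a\<close>: \<open>C\<close> dominates the start and is mapped
    below itself, so the induction bound is uniform in the time.\<close>
  define C where "C = a + c / (1 - l)"
  have C: "0 \<le> C" "a \<le> C" "l * C + c \<le> C"
  proof -
    have "0 \<le> c / (1 - l)" using l by simp
    then show "0 \<le> C" "a \<le> C" using a(2) by (auto simp: C_def)
    have "(1 - l) * C = (1 - l) * a + c" using l by (simp add: C_def field_simps)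
    moreover have "0 \<le> (1 - l) * a" using a(2) l by simp
    ultimately show "l * C + c \<le> C" by (simp add: algebra_simps)
  qed
  have k: "integral\<^sup>N (chain_law K M k) L \<le> ennreal C" for k
  proof (induction k)
    case 0
    then show ?case using a C by (simp add: ennreal_leI)
  next
    case (Suc k)
    have sk: "sets (chain_law K M k) = sets S" "prob_space (chain_law K M k)"
      using cl[of k] by (auto simp: space_prob_algebra)
    interpret prob_space "chain_law K M k" by fact
    have K': "K \<in> chain_law K M k \<rightarrow>\<^sub>M subprob_algebra S"
      using measurable_prob_algebraD[OF K] measurable_cong_sets[OF sk(1) refl] by blast
    have L': "L \<in> borel_measurable (chain_law K M k)"
      using L(1) measurable_cong_sets[OF sk(1) refl] by blast
    have "integral\<^sup>N (chain_law K M (Suc k)) L = (\<integral>\<^sup>+x. integral\<^sup>N (K x) L \<partial>chain_law K M k)"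
      using nn_integral_bind[OF L(1) K'] by simp
    also have "\<dots> \<le> (\<integral>\<^sup>+x. ennreal l * L x + ennreal c \<partial>chain_law K M k)"
      using drift sets_eq_imp_space_eq[OF sk(1)] by (intro nn_integral_mono) auto
    also have "\<dots> = ennreal l * integral\<^sup>N (chain_law K M k) L + ennreal c"
      using L' by (subst nn_integral_add) (auto simp: nn_integral_cmult emeasure_space_1)
    also have "\<dots> \<le> ennreal l * ennreal C + ennreal c"
      using Suc by (intro add_mono mult_left_mono) auto
    also have "\<dots> = ennreal (l * C + c)"
      using l C by (simp add: ennreal_mult ennreal_plus)
    also have "\<dots> \<le> ennreal C"
      using C by (intro ennreal_leI)
    finally show ?case .
  qed
  have "integral\<^sup>N (cesaro_law K M n) L \<le> ennreal C" for n
  proof -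
    have "(\<Sum>k\<le>n. integral\<^sup>N (chain_law K M k) L) \<le> (\<Sum>k\<le>n. ennreal C)"
      using k by (intro sum_mono)
    also have "\<dots> = ennreal (real (Suc n) * C)"
      using C by (simp add: ennreal_mult ennreal_of_nat_eq_real_of_nat)
    finally have "integral\<^sup>N (cesaro_law K M n) L \<le> ennreal (real (Suc n) * C) / ennreal (real (Suc n))"
      unfolding nn_integral_cesaro_law[OF K M L(1)] by (rule divide_right_mono_ennreal)
    also have "\<dots> = ennreal C"
      using C by (subst divide_ennreal) auto
    finally show ?thesis .
  qed
  with C that show thesis by blast
qed

section \<open>No mass at zero or infinite income\<close>

text \<open>The left end of an interval encodes income 0 and the right end infinite income. With
  both ends left out, the two ways of losing mass become one closed set, the complement.\<close>

definition code_range :: "'s::finite itself \<Rightarrow> real set" where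
  "code_range _ = (\<Union>i::'s. {2 * real (to_nat i)<..<2 * real (to_nat i) + 1})"

lemma open_code_range: "open (code_range TYPE('s::finite))"
  by (auto simp: code_range_def)

text \<open>Replacing \<open>x\<close> by \<open>1 / x\<close> turns \<open>x / (1 + x)\<close> into
  \<open>1 - x / (1 + x)\<close>, so incomes between \<open>e\<close> and \<open>1 / e\<close> keep
  the same margin \<open>e / (1 + e)\<close> from both ends of their interval.\<close>

lemma le_infdist_line_code:
  fixes s :: "real \<times> 's::finite"
  assumes "0 < e" "e \<le> fst s" "fst s \<le> 1 / e"
  shows "e / (1 + e) \<le> infdist (line_code s) (- code_range TYPE('s))"
proof -
  obtain x i where s: "s = (x, i)" by force
  have x: "e \<le> x" "x \<le> 1 / e" using assms by (auto simp: s)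
  have "x * e \<le> 1" using x(2) assms(1) by (simp add: field_simps)
  then have "e / (1 + e) \<le> 1 / (1 + x)" and lo: "e / (1 + e) \<le> x / (1 + x)"
    using x(1) assms(1) by (auto simp: field_simps)
  moreover have "1 / (1 + x) = 1 - x / (1 + x)"
    using x(1) assms(1) by (simp add: field_simps)
  ultimately have hi: "x / (1 + x) + e / (1 + e) \<le> 1" by linarith
  \<comment> \<open>The distance to the empty set is 0 by convention, so the complement must be
    known to be nonempty.\<close>
  have "0 \<notin> code_range TYPE('s)" by (auto simp: code_range_def)
  then have ne: "- code_range TYPE('s) \<noteq> {}" by auto
  have "e / (1 + e) \<le> dist (line_code s) z" if "z \<in> - code_range TYPE('s)" for z
  proof (rule ccontr)
    assume "\<not> ?thesis"
    then have "2 * real (to_nat i) < z" "z < 2 * real (to_nat i) + 1"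
      using lo hi by (auto simp: dist_real_def s line_code_def abs_if split: if_splits)
    with that show False by (auto simp: code_range_def)
  qed
  then show ?thesis
    using ne by (auto simp: infdist_notempty intro!: cINF_greatest)
qed

text \<open>Markov's inequality along the averages, carried over to the limit: wherever the cut-off
  \<open>h\<close> is positive, \<open>L\<close> is at least \<open>R\<close>, so \<open>h\<close>
  has mean at most \<open>C / R\<close>, and \<open>R\<close> is arbitrary.\<close>

lemma null_outside_code_range:
  fixes A :: "nat \<Rightarrow> (real \<times> 's::finite) measure" and N :: "real measure"
  assumes A: "\<And>n. A n \<in> space (prob_algebra state_space)" and N: "real_distribution N"
    and conv: "weak_conv_m (\<lambda>n. distr (A n) borel line_code) N"
    and L: "\<And>n. integral\<^sup>N (A n) L \<le> ennreal C"
    and coercive: "\<And>R::real. \<exists>e>0. \<forall>x i. 0 \<le> x \<and> (x < e \<or> 1 / e < x) \<longrightarrow> ennreal R \<le> L (x, i)"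
  shows "emeasure N (- code_range TYPE('s)) = 0"
proof -
  interpret N: real_distribution N by fact
  define Z where "Z = - code_range TYPE('s)"
  have Z: "closed Z" "0 \<in> Z"
    using open_code_range[where 's='s] by (auto simp: Z_def closed_def code_range_def)
  then have Zs: "Z \<in> sets N" by simp
  \<comment> \<open>\<open>ennreal\<close> sends a negative \<open>C\<close> to 0, whence
    \<open>max 0 C\<close>.\<close>
  have "measure N Z \<le> max 0 C / R" if R: "0 < R" for R
  proof -
    obtain e where e: "0 < e" "\<And>x i. 0 \<le> x \<Longrightarrow> x < e \<or> 1 / e < x \<Longrightarrow> ennreal R \<le> L (x, i)"
      using coercive by blast
    \<comment> \<open>Weak convergence controls continuous integrands, so the indicator of
      \<open>Z\<close> is replaced by a tent that is 1 on \<open>Z\<close> and vanishes from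
      distance \<open>e / (1 + e)\<close> on, in particular on the codes of all incomes between
      \<open>e\<close> and \<open>1 / e\<close>.\<close>
    define h where "h = (\<lambda>t. max 0 (1 - infdist t Z / (e / (1 + e))))"
    have h: "isCont h t" "0 \<le> h t" "h t \<le> 1" "norm (h t) \<le> 1" for t
      using e(1) infdist_nonneg[of t Z] unfolding h_def
      by (auto intro!: continuous_intros continuous_infdist)
    have hm: "h \<in> borel_measurable borel"
      using h(1) by (intro borel_measurable_continuous_onI) (auto intro: continuous_at_imp_continuous_on)
    have bd: "integral\<^sup>L (distr (A n) borel line_code) h \<le> max 0 C / R" for n
    proof -
      have sA: "sets (A n) = sets state_space" "prob_space (A n)"
        using A[of n] by (auto simp: space_prob_algebra)
      interpret prob_space "A n" by fact
      have sp: "space (A n) = {0..} \<times> UNIV"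
        using sets_eq_imp_space_eq[OF sA(1)] by (simp add: space_state_space)
      have c[measurable]: "line_code \<in> A n \<rightarrow>\<^sub>M borel"
        using measurable_line_code measurable_cong_sets[OF sA(1) refl] by blast
      note hm[measurable]
      have int: "integrable (A n) (\<lambda>s. R * h (line_code s))"
        using h by (intro integrable_mult_right integrable_const_bound[of _ 1]) auto
      have "ennreal (R * integral\<^sup>L (distr (A n) borel line_code) h) = ennreal (\<integral>s. R * h (line_code s) \<partial>A n)"
        by (subst integral_distr[OF c hm]) simp
      also have "\<dots> = (\<integral>\<^sup>+s. ennreal (R * h (line_code s)) \<partial>A n)"
        using int h R by (intro nn_integral_eq_integral[symmetric]) auto
      also have "\<dots> \<le> integral\<^sup>N (A n) L"
      proof (rule nn_integral_mono)
        fix s :: "real \<times> 's" assume "s \<in> space (A n)"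
        then obtain x i where s: "s = (x, i)" "0 \<le> x" by (auto simp: sp)
        show "ennreal (R * h (line_code s)) \<le> L s"
        proof (cases "x < e \<or> 1 / e < x")
          case True
          have "ennreal (R * h (line_code s)) \<le> ennreal (R * 1)"
            using h R by (intro ennreal_leI mult_left_mono) auto
          with e(2)[OF s(2) True, of i] s(1) show ?thesis by auto
        next
          case False
          then have "e / (1 + e) \<le> infdist (line_code s) Z"
            using le_infdist_line_code[of e s] e(1) s by (auto simp: Z_def)
          then have "1 \<le> infdist (line_code s) Z / (e / (1 + e))"
            using e(1) by (subst le_divide_eq_1_pos) auto
          then show ?thesis by (simp add: h_def)
        qed
      qed
      also have "\<dots> \<le> ennreal C" by (rule L)
      also have "\<dots> \<le> ennreal (max 0 C)" by (auto intro: ennreal_leI)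
      finally have "R * integral\<^sup>L (distr (A n) borel line_code) h \<le> max 0 C"
        by (subst (asm) ennreal_le_iff) auto
      then show ?thesis using R by (simp add: field_simps)
    qed
    have "(\<lambda>n. integral\<^sup>L (distr (A n) borel line_code) h) \<longlonglongrightarrow> integral\<^sup>L N h"
      by (rule weak_conv_imp_integral_bdd_continuous_conv[OF coded_distribution(1)[OF A] N conv h(1,4)])
    then have "integral\<^sup>L N h \<le> max 0 C / R"
      using bd by (intro LIMSEQ_le_const2) auto
    moreover have "measure N Z \<le> integral\<^sup>L N h"
    proof -
      have "measure N Z = integral\<^sup>L N (indicator Z)"
        using Zs by simp
      also have "\<dots> \<le> integral\<^sup>L N h"
      proof (rule integral_mono)
        show "integrable N h"
          using h(4) hm by (intro N.integrable_const_bound[of _ 1]) auto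
        show "indicator Z t \<le> h t" for t
          using h(2)[of t] by (auto simp: indicator_def h_def)
        show "integrable N (indicator Z :: real \<Rightarrow> real)"
          using Zs by (intro N.integrable_const_bound[of _ 1]) (auto simp: indicator_def)
      qed
      finally show ?thesis .
    qed
    ultimately show ?thesis by linarith
  qed
  then have "measure N Z \<le> 0"
    by (intro tendsto_lowerbound[of "\<lambda>R. max 0 C / R" 0 at_top] tendsto_divide_0[OF tendsto_const])
       (auto intro: filterlim_at_top_imp_at_infinity filterlim_ident eventually_mono[OF eventually_gt_at_top[of 0]])
  then show ?thesis
    unfolding Z_def[symmetric] by (simp add: N.emeasure_eq_measure antisym)
qed

text \<open>Continuity for positive incomes suffices because a decoded test function can be
  discontinuous only off \<open>code_range\<close>, which is null for the limit. Coercivity forces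
  \<open>L (0, i) = \<top>\<close>; this keeps the limit away from zero income.\<close>

theorem krylov_bogoliubov:
  fixes K :: "real \<times> 's::finite \<Rightarrow> (real \<times> 's) measure" and L :: "real \<times> 's \<Rightarrow> ennreal"
  assumes K: "K \<in> state_space \<rightarrow>\<^sub>M prob_algebra state_space"
    and feller: "\<And>g :: real \<times> 's \<Rightarrow> real. \<And>i. g \<in> borel_measurable state_space \<Longrightarrow> (\<And>s. \<bar>g s\<bar> \<le> 1) \<Longrightarrow>
      (\<And>j. continuous_on {0..} (\<lambda>x. g (x, j))) \<Longrightarrow> continuous_on {0<..} (\<lambda>x. integral\<^sup>L (K (x, i)) g)"
    and L: "L \<in> borel_measurable state_space"
    and drift: "\<And>s. s \<in> space state_space \<Longrightarrow> integral\<^sup>N (K s) L \<le> ennreal l * L s + ennreal c"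
    and l: "0 \<le> l" "l < 1" "0 \<le> c"
    and coercive: "\<And>R::real. \<exists>e>0. \<forall>x i. 0 \<le> x \<and> (x < e \<or> 1 / e < x) \<longrightarrow> ennreal R \<le> L (x, i)"
    and s0: "s0 \<in> space state_space" "L s0 < \<infinity>"
  shows "\<exists>\<mu>. stationary_distribution K \<mu> \<and> emeasure \<mu> ({0} \<times> UNIV) = 0"
proof -
  define A where "A = cesaro_law K (return state_space s0)"
  have M0: "return state_space s0 \<in> space (prob_algebra state_space)"
    using s0 by (auto simp: space_prob_algebra intro!: prob_space_return)
  have A: "A n \<in> space (prob_algebra state_space)" for n
    unfolding A_def by (rule cesaro_law_in_space[OF K M0])
  have "integral\<^sup>N (return state_space s0) L < \<infinity>"
    using s0 L by (simp add: nn_integral_return)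
  then obtain C :: real where C: "\<And>n. integral\<^sup>N (A n) L \<le> ennreal C"
    unfolding A_def using nn_integral_cesaro_law_drift[OF K M0 L _ drift l] by blast
  obtain r N where r: "strict_mono r" and N: "real_distribution N"
    and conv0: "weak_conv_m ((\<lambda>n. distr (A n) borel line_code) \<circ> id \<circ> r) N"
    using tight_imp_convergent_subsubsequence[OF tight_coded[of A, OF A] strict_mono_id] by blast
  have conv: "weak_conv_m (\<lambda>n. distr (A (r n)) borel line_code) N"
    using conv0 by (simp add: comp_def)
  interpret N: real_distribution N by fact
  have Z: "emeasure N (- code_range TYPE('s)) = 0"
    by (rule null_outside_code_range[OF A N conv C coercive])
  have Zs: "- code_range TYPE('s) \<in> sets N"
    using open_code_range[where 's='s] by (auto intro: borel_comp)
  have dec[measurable]: "line_decode \<in> N \<rightarrow>\<^sub>M (state_space :: (real \<times> 's) measure)"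
    using measurable_line_decode measurable_cong_sets[OF N.events_eq_borel refl] by blast
  define \<mu> where "\<mu> = distr N state_space (line_decode :: real \<Rightarrow> real \<times> 's)"
  have \<mu>: "\<mu> \<in> space (prob_algebra state_space)"
    using N.prob_space_distr[OF dec] by (simp add: \<mu>_def space_prob_algebra)
  have sp\<mu>: "sets \<mu> = sets state_space" "space \<mu> = {0..} \<times> UNIV"
    by (simp_all add: \<mu>_def space_state_space)
  have lim: "(\<lambda>n. integral\<^sup>L (A (r n)) g) \<longlonglongrightarrow> integral\<^sup>L \<mu> g"
    if g: "g \<in> borel_measurable state_space" "\<And>s. \<bar>g s\<bar> \<le> 1" "\<And>i. continuous_on {0<..} (\<lambda>x. g (x, i))"
    for g :: "real \<times> 's \<Rightarrow> real"
  proof -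
    have "{t. \<not> isCont (\<lambda>t. g (line_decode t)) t} \<subseteq> - code_range TYPE('s)"
      using isCont_comp_line_decode[OF g(3)] by (auto simp: code_range_def)
    then have "emeasure N {t. \<not> isCont (\<lambda>t. g (line_decode t)) t} = 0"
      using emeasure_mono[OF _ Zs] Z by fastforce
    then have "(\<lambda>n. integral\<^sup>L (distr (A (r n)) borel line_code) (\<lambda>t. g (line_decode t)))
        \<longlonglongrightarrow> integral\<^sup>L N (\<lambda>t. g (line_decode t))"
      using g(2) measurable_compose[OF measurable_line_decode g(1)]
      by (intro weak_conv_imp_bdd_ae_continuous_conv[OF coded_distribution(1)[OF A] N conv, of _ 1]) auto
    moreover have "integral\<^sup>L N (\<lambda>t. g (line_decode t)) = integral\<^sup>L \<mu> g"
      unfolding \<mu>_def by (rule integral_distr[OF dec g(1), symmetric])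
    ultimately show ?thesis
      unfolding coded_distribution(3)[OF A g(1)] by simp
  qed
  have bind: "\<mu> \<bind> K \<in> space (prob_algebra state_space)"
    using prob_space_bind'[OF \<mu> K] sets_bind'[OF \<mu> K] by (simp add: space_prob_algebra)
  have "\<mu> \<bind> K = \<mu>"
  proof (rule measure_eqI_continuous[OF bind \<mu>])
    fix g :: "real \<times> 's \<Rightarrow> real"
    assume g: "g \<in> borel_measurable state_space" "\<And>s. \<bar>g s\<bar> \<le> 1" "\<And>i. continuous_on {0..} (\<lambda>x. g (x, i))"
    define Pg where "Pg = (\<lambda>s. indicator (space state_space) s * integral\<^sup>L (K s) g)"
    have m: "Pg \<in> borel_measurable state_space"
      unfolding Pg_def
      using measurable_compose[OF measurable_prob_algebraD[OF K] integral_measurable_subprob_algebra[OF g(1)]]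
      by measurable
    have b: "\<bar>Pg s\<bar> \<le> 1" for s
      using abs_integral_le[OF measurable_space[OF K] g(1,2), of s] by (auto simp: indicator_def Pg_def)
    have "continuous_on {0<..} (\<lambda>x. Pg (x, i)) = continuous_on {0<..} (\<lambda>x. integral\<^sup>L (K (x, i)) g)" for i
      by (intro continuous_on_cong) (auto simp: Pg_def space_state_space)
    then have "(\<lambda>n. integral\<^sup>L (A (r n)) Pg) \<longlonglongrightarrow> integral\<^sup>L \<mu> Pg"
      using feller[OF g] by (intro lim m b) auto
    moreover have "(\<lambda>n. integral\<^sup>L (A (r n)) g) \<longlonglongrightarrow> integral\<^sup>L \<mu> g"
        by (intro lim g(1,2) continuous_on_subset[OF g(3)]) auto
    ultimately have "(\<lambda>n. integral\<^sup>L (A (r n)) Pg - integral\<^sup>L (A (r n)) g) \<longlonglongrightarrow> integral\<^sup>L \<mu> Pg - integral\<^sup>L \<mu> g"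
      by (rule tendsto_diff)
    moreover have "(\<lambda>n. integral\<^sup>L (A (r n)) Pg - integral\<^sup>L (A (r n)) g) \<longlonglongrightarrow> 0"
      using LIMSEQ_subseq_LIMSEQ[OF cesaro_law_asymp_invariant[OF K M0 g(1,2)] r]
      by (simp add: A_def Pg_def comp_def)
    ultimately have "integral\<^sup>L \<mu> Pg - integral\<^sup>L \<mu> g = 0"
      by (rule LIMSEQ_unique)
    moreover have "integral\<^sup>L (\<mu> \<bind> K) g = integral\<^sup>L \<mu> Pg"
      unfolding integral_bind_prob_algebra[OF \<mu> K g(1,2)]
      by (intro Bochner_Integration.integral_cong) (auto simp: Pg_def sp\<mu> space_state_space)
    ultimately show "integral\<^sup>L (\<mu> \<bind> K) g = integral\<^sup>L \<mu> g"
      by simp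
  qed
  then have "stationary_distribution K \<mu>"
    using emeasure_bind_prob_algebra[OF \<mu> K] \<mu>
    by (auto simp: stationary_distribution_def space_prob_algebra)
  moreover have "emeasure \<mu> ({0} \<times> UNIV) = 0"
  proof -
    have "emeasure \<mu> ({0} \<times> UNIV) = emeasure N (line_decode -` ({0} \<times> (UNIV :: 's set)) \<inter> space N)"
      unfolding \<mu>_def by (intro emeasure_distr dec pair_measureI) (auto simp: sets_restrict_space_iff)
    also have "\<dots> \<le> emeasure N (- code_range TYPE('s))"
    proof (intro emeasure_mono Zs subsetI)
      \<comment> \<open>The default income 0 of the decoder does no harm: it occurs only off the
        open intervals, and inside them \<open>r / (1 - r)\<close> is positive.\<close>
      fix t assume "t \<in> line_decode -` ({0} \<times> (UNIV :: 's set)) \<inter> space N"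
      then have 0: "fst (line_decode t :: real \<times> 's) = 0" by (auto simp: vimage_def)
      have "t \<notin> {2 * real (to_nat i)<..<2 * real (to_nat i) + 1}" for i :: 's
        using 0 by (auto simp: line_decode_eq[of i])
      then show "t \<in> - code_range TYPE('s)" by (auto simp: code_range_def)
    qed
    finally show ?thesis using Z by simp
  qed
  ultimately show ?thesis by blast
qed

section \<open>Right derivatives of concave functions\<close>

text \<open>The supremum is the right derivative only for concave functions. It is extended-valued because
  \<open>u\<close> and \<open>V\<close> have slope \<open>\<infinity>\<close> at zero.\<close>

definition right_deriv :: "(real \<Rightarrow> real) \<Rightarrow> real \<Rightarrow> ennreal" where
  "right_deriv g x = (SUP n. ennreal (real (Suc n) * (g (x + 1 / real (Suc n)) - g x)))"

lemma concave_on_quotient_antimono: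
  fixes g :: "real \<Rightarrow> real"
  assumes g: "concave_on {0..} g" and "0 \<le> x" "0 < h" "h \<le> k"
  shows "(g (x + k) - g x) / k \<le> (g (x + h) - g x) / h"
proof -
  have "(1 - h / k) * g x + h / k * g (x + k) \<le> g ((1 - h / k) *\<^sub>R x + (h / k) *\<^sub>R (x + k))"
    using assms by (intro concave_onD[OF g]) auto
  also have "(1 - h / k) *\<^sub>R x + (h / k) *\<^sub>R (x + k) = x + h"
    using assms by (simp add: field_simps)
  finally have "h / k * (g (x + k) - g x) \<le> g (x + h) - g x"
    by (simp add: algebra_simps)
  then show ?thesis
    using assms by (simp add: field_simps)
qed

lemma concave_on_three_chord:
  fixes g :: "real \<Rightarrow> real"
  assumes g: "concave_on {0..} g" and "0 \<le> x" "0 < h" "0 < k"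
  shows "(g (x + h + k) - g (x + h)) / k \<le> (g (x + h) - g x) / h"
proof -
  have "(g (x + (h + k)) - g x) / (h + k) \<le> (g (x + h) - g x) / h"
    using assms by (intro concave_on_quotient_antimono[OF g]) auto
  then have "h * (g (x + h + k) - g x) \<le> (h + k) * (g (x + h) - g x)"
    using assms by (simp add: field_simps)
  then have "h * (g (x + h + k) - g (x + h)) \<le> k * (g (x + h) - g x)"
    by (simp add: algebra_simps)
  then show ?thesis
    using assms by (simp add: field_simps)
qed

text \<open>\<open>x + h\<close> and \<open>y\<close> are the convex combinations of
  \<open>x\<close> and \<open>y + h\<close> with the weights \<open>t\<close> and
  \<open>1 - t\<close> interchanged; adding the two chord inequalities cancels the weights.\<close>

lemma concave_on_increment_antimono:
  fixes g :: "real \<Rightarrow> real"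
  assumes g: "concave_on {0..} g" and "0 \<le> x" "x \<le> y" "0 \<le> h"
  shows "g (y + h) - g y \<le> g (x + h) - g x"
proof (cases "h = 0 \<or> x = y")
  case False
  define t where "t = h / (y - x + h)"
  have t: "0 \<le> t" "t \<le> 1" "t * (y - x + h) = h"
    using assms False by (auto simp: t_def)
  have e: "(1 - t) *\<^sub>R x + t *\<^sub>R (y + h) = x + h" "(1 - t) *\<^sub>R (y + h) + t *\<^sub>R x = y"
    using t(3) by (auto simp: algebra_simps)
  have "(1 - t) * g x + t * g (y + h) \<le> g (x + h)" "(1 - t) * g (y + h) + t * g x \<le> g y"
    using concave_onD[OF g t(1,2), of x "y + h"] concave_onD[OF g t(1,2), of "y + h" x] assms
    unfolding e by auto
  then show ?thesis by (simp add: algebra_simps)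
qed auto

lemma right_deriv_ge_quotient:
  assumes "concave_on {0..} g" "0 \<le> x" "0 < h"
  shows "ennreal ((g (x + h) - g x) / h) \<le> right_deriv g x"
proof -
  obtain n where n: "1 / real (Suc n) < h"
    using assms(3) nat_approx_posE by blast
  have "(g (x + h) - g x) / h \<le> (g (x + 1 / real (Suc n)) - g x) / (1 / real (Suc n))"
    using n assms by (intro concave_on_quotient_antimono) auto
  also have "\<dots> = real (Suc n) * (g (x + 1 / real (Suc n)) - g x)"
    by simp
  finally show ?thesis
    unfolding right_deriv_def by (intro SUP_upper2[OF UNIV_I] ennreal_leI)
qed

lemma right_deriv_le_quotient:
  assumes "concave_on {0..} g" "0 < h" "h \<le> x"
  shows "right_deriv g x \<le> ennreal ((g x - g (x - h)) / h)"
  unfolding right_deriv_def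
proof (rule SUP_least, rule ennreal_leI)
  fix n
  show "real (Suc n) * (g (x + 1 / real (Suc n)) - g x) \<le> (g x - g (x - h)) / h"
    using concave_on_three_chord[OF assms(1), of "x - h" h "1 / real (Suc n)"] assms(2,3)
    by (simp add: mult.commute)
qed

lemma right_deriv_antimono:
  assumes "concave_on {0..} g" "0 \<le> x" "x \<le> y"
  shows "right_deriv g y \<le> right_deriv g x"
  unfolding right_deriv_def
  using concave_on_increment_antimono[OF assms]
  by (intro SUP_mono' ennreal_leI mult_left_mono) auto

lemma right_deriv_finite:
  assumes "concave_on {0..} g" "0 < x"
  shows "right_deriv g x < \<infinity>"
  using right_deriv_le_quotient[OF assms(1), of x x] assms(2)
  by (auto intro: le_less_trans)

lemma incseq_right_quotients:
  assumes "concave_on {0..} g" "0 \<le> x"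
  shows "incseq (\<lambda>n. real (Suc n) * (g (x + 1 / real (Suc n)) - g x))"
proof (rule monoI)
  fix m n :: nat assume "m \<le> n"
  then show "real (Suc m) * (g (x + 1 / real (Suc m)) - g x) \<le> real (Suc n) * (g (x + 1 / real (Suc n)) - g x)"
    using concave_on_quotient_antimono[OF assms, of "1 / real (Suc n)" "1 / real (Suc m)"]
    by (simp add: frac_le mult.commute)
qed

lemma right_deriv_ge_deriv:
  assumes g: "concave_on {0..} g" and "0 \<le> x" and D: "(g has_real_derivative D) (at x)"
  shows "ennreal D \<le> right_deriv g x"
proof (rule tendsto_upperbound)
  have "((\<lambda>h. (g (x + h) - g x) / h) \<longlongrightarrow> D) (at_right 0)"
    using D unfolding DERIV_def by (rule filterlim_mono) (auto simp: at_within_le_at)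
  then show "((\<lambda>h. ennreal ((g (x + h) - g x) / h)) \<longlongrightarrow> ennreal D) (at_right 0)"
    by (rule tendsto_ennrealI)
  show "\<forall>\<^sub>F h in at_right 0. ennreal ((g (x + h) - g x) / h) \<le> right_deriv g x"
    using right_deriv_ge_quotient[OF g assms(2)]
    by (auto simp: eventually_at_filter)
qed auto

text \<open>Left quotients are what bounds a right slope of a concave function from above.
  \<open>X\<close> is arbitrary because the bound serves both the slope of \<open>g\<close> itself
  and, in the envelope argument, the slope of a different function.\<close>

lemma le_deriv_of_left_quotients:
  fixes g :: "real \<Rightarrow> real"
  assumes D: "(g has_real_derivative D) (at x)" and "0 < x"
    and X: "\<And>h. 0 < h \<Longrightarrow> h \<le> x \<Longrightarrow> X \<le> ennreal ((g x - g (x - h)) / h)"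
  shows "X \<le> ennreal D"
proof (rule tendsto_lowerbound)
  have "((\<lambda>h. (g (x + h) - g x) / h) \<longlongrightarrow> D) (at_left 0)"
    using D unfolding DERIV_def by (rule filterlim_mono) (auto simp: at_within_le_at)
  then have "((\<lambda>h. (g (x - h) - g x) / (- h)) \<longlongrightarrow> D) (at_right 0)"
    by (simp add: filterlim_at_left_to_right)
  moreover have "(g (x - h) - g x) / (- h) = (g x - g (x - h)) / h" for h
    by (simp add: divide_simps)
  ultimately show "((\<lambda>h. ennreal ((g x - g (x - h)) / h)) \<longlongrightarrow> ennreal D) (at_right 0)"
    by (auto intro: tendsto_ennrealI)
  have "\<forall>\<^sub>F h in at_right 0. h \<in> {0<..<x}"
    using eventually_at_right_real[OF \<open>0 < x\<close>] .
  then show "\<forall>\<^sub>F h in at_right 0. X \<le> ennreal ((g x - g (x - h)) / h)"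
    by eventually_elim (use X in auto)
qed auto

lemma right_deriv_eq_deriv:
  assumes g: "concave_on {0..} g" and "0 < x" and D: "(g has_real_derivative D) (at x)"
  shows "right_deriv g x = ennreal D"
  using right_deriv_ge_deriv[OF g _ D] le_deriv_of_left_quotients[OF D \<open>0 < x\<close>]
    right_deriv_le_quotient[OF g] \<open>0 < x\<close> by (meson antisym less_imp_le)

text \<open>A chain rule for quotients, hence valid for infinite slopes too. Given one quotient of
  each factor, a small enough step of \<open>f\<close> produces an increment over which
  \<open>g\<close> is at least as steep as over \<open>1 / (m + 1)\<close>, while the quotient of
  \<open>f\<close> only grows.\<close>

lemma right_deriv_comp:
  assumes g: "concave_on {0..} g" "mono_on {0..} g"
    and f: "concave_on {0..} f" "mono_on {0..} f" "continuous_on {0..} f"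
    and y: "0 \<le> y" "0 \<le> f y"
  shows "right_deriv g (f y) * right_deriv f y \<le> right_deriv (\<lambda>y. g (f y)) y"
proof -
  let ?a = "f y"
  have "ennreal (real (Suc m) * (g (?a + 1 / real (Suc m)) - g ?a)) * ennreal (real (Suc n) * (f (y + 1 / real (Suc n)) - f y))
      \<le> right_deriv (\<lambda>y. g (f y)) y" for m n
  proof -
    define q where "q = real (Suc m) * (g (?a + 1 / real (Suc m)) - g ?a)"
    have q: "0 \<le> q"
      using mono_onD[OF g(2), of ?a "?a + 1 / real (Suc m)"] y by (simp add: q_def)
    have "(\<lambda>k. f (y + 1 / real (Suc k))) \<longlonglongrightarrow> f (y + 0)"
      using y by (intro continuous_on_tendsto_compose[OF f(3)] tendsto_add tendsto_const) (use LIMSEQ_inverse_real_of_nat in \<open>auto simp: inverse_eq_divide\<close>)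
    then have "\<forall>\<^sub>F k in sequentially. dist (f (y + 1 / real (Suc k))) ?a < 1 / real (Suc m)"
      by (intro tendstoD) auto
    then obtain N0 where N0: "\<And>k. N0 \<le> k \<Longrightarrow> dist (f (y + 1 / real (Suc k))) ?a < 1 / real (Suc m)"
      by (auto simp: eventually_sequentially)
    \<comment> \<open>Beyond \<open>n\<close>, so that the quotient of \<open>f\<close> does not
      drop; beyond \<open>N0\<close>, so that the increment \<open>d\<close> of \<open>f\<close>
      fits into the step of \<open>g\<close>.\<close>
    define N where "N = max n N0"
    define d where "d = f (y + 1 / real (Suc N)) - ?a"
    have d: "0 \<le> d" "d \<le> 1 / real (Suc m)"
      using N0[of N] mono_onD[OF f(2), of y "y + 1 / real (Suc N)"] y by (auto simp: N_def d_def dist_real_def)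
    have qd: "q * d \<le> g (?a + d) - g ?a"
    proof (cases "d = 0")
      case False
      then have "(g (?a + 1 / real (Suc m)) - g ?a) / (1 / real (Suc m)) \<le> (g (?a + d) - g ?a) / d"
        using d y by (intro concave_on_quotient_antimono[OF g(1)]) auto
      then have "q \<le> (g (?a + d) - g ?a) / d"
        by (simp add: q_def mult.commute)
      then show ?thesis using d False by (simp add: field_simps)
    qed simp
    have "real (Suc n) * (f (y + 1 / real (Suc n)) - f y) \<le> real (Suc N) * d"
      using incseqD[OF incseq_right_quotients[OF f(1) y(1)], of n N] by (simp add: N_def d_def)
    then have "q * (real (Suc n) * (f (y + 1 / real (Suc n)) - f y)) \<le> q * (real (Suc N) * d)"
      using q by (rule mult_left_mono)
    also have "\<dots> \<le> real (Suc N) * (g (?a + d) - g ?a)"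
      using mult_left_mono[OF qd, of "real (Suc N)"] by (simp add: ac_simps)
    finally have "ennreal (q * (real (Suc n) * (f (y + 1 / real (Suc n)) - f y))) \<le> right_deriv (\<lambda>y. g (f y)) y"
      unfolding right_deriv_def by (intro SUP_upper2[of N] ennreal_leI) (auto simp: d_def)
    then show ?thesis
      unfolding q_def[symmetric] by (simp only: ennreal_mult'[OF q])
  qed
  then show ?thesis
    unfolding right_deriv_def[of g] right_deriv_def[of f]
    by (simp add: SUP_mult_left_ennreal SUP_mult_right_ennreal SUP_le_iff)
qed

text \<open>Concavity makes the quotients increase as the step shrinks and monotonicity makes them
  nonnegative, so monotone convergence moves the slope out of the integral even where it is
  infinite.\<close>

lemma nn_integral_right_deriv_le:
  assumes F: "\<And>z. z \<in> space M \<Longrightarrow> concave_on {0..} (\<lambda>y. F y z)" "\<And>z. z \<in> space M \<Longrightarrow> mono_on {0..} (\<lambda>y. F y z)"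
    and int: "\<And>y. 0 \<le> y \<Longrightarrow> integrable M (F y)" and y: "0 \<le> y"
  shows "(\<integral>\<^sup>+z. right_deriv (\<lambda>y. F y z) y \<partial>M) \<le> right_deriv (\<lambda>y. \<integral>z. F y z \<partial>M) y"
proof -
  let ?q = "\<lambda>n z. ennreal (real (Suc n) * (F (y + 1 / real (Suc n)) z - F y z))"
  note [measurable] = borel_measurable_integrable[OF int]
  have i: "integrable M (\<lambda>z. real (Suc n) * (F (y + 1 / real (Suc n)) z - F y z))" for n
    using y by (intro integrable_mult_right Bochner_Integration.integrable_diff int) auto
  have "(\<integral>\<^sup>+z. right_deriv (\<lambda>y. F y z) y \<partial>M) = (\<integral>\<^sup>+z. (SUP n. ?q n z) \<partial>M)"
    by (simp add: right_deriv_def)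
  also have "\<dots> = (SUP n. \<integral>\<^sup>+z. ?q n z \<partial>M)"
  proof (rule nn_integral_monotone_convergence_SUP_AE)
    show "AE z in M. ?q n z \<le> ?q (Suc n) z" for n
      by (intro AE_I2 ennreal_leI incseq_SucD[OF incseq_right_quotients[OF F(1) y]])
    show "?q n \<in> borel_measurable M" for n
      using borel_measurable_integrable[OF i] by auto
  qed
  also have "\<dots> \<le> right_deriv (\<lambda>y. \<integral>z. F y z \<partial>M) y"
    unfolding right_deriv_def
  proof (intro SUP_mono bexI[OF _ UNIV_I])
    fix n
    have "(\<integral>\<^sup>+z. ?q n z \<partial>M) = ennreal (\<integral>z. real (Suc n) * (F (y + 1 / real (Suc n)) z - F y z) \<partial>M)"
    proof (intro nn_integral_eq_integral i AE_I2)
      fix z assume "z \<in> space M"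
      then show "0 \<le> real (Suc n) * (F (y + 1 / real (Suc n)) z - F y z)"
        using mono_onD[OF F(2), of z y "y + 1 / real (Suc n)"] y by auto
    qed
    also have "(\<integral>z. real (Suc n) * (F (y + 1 / real (Suc n)) z - F y z) \<partial>M) =
      real (Suc n) * ((\<integral>z. F (y + 1 / real (Suc n)) z \<partial>M) - (\<integral>z. F y z \<partial>M))"
      using y by (simp add: int Bochner_Integration.integral_diff del: of_nat_Suc)
    finally show "(\<integral>\<^sup>+z. ?q n z \<partial>M) \<le> ennreal (real (Suc n) * ((\<integral>z. F (y + 1 / real (Suc n)) z \<partial>M) - (\<integral>z. F y z \<partial>M)))"
      by simp
  qed
  finally show ?thesis .
qed

section \<open>Cauchy-Schwarz for extended nonnegative functions\<close>

text \<open>The infinite case is separate because \<open>enn2real \<top>\<close> is 0.\<close>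

definition esqrt :: "ennreal \<Rightarrow> ennreal" where
  "esqrt a = (if a = \<top> then \<top> else ennreal (sqrt (enn2real a)))"

lemma esqrt_top [simp]: "esqrt \<top> = \<top>"
  by (simp add: esqrt_def)

lemma esqrt_0 [simp]: "esqrt 0 = 0"
  by (simp add: esqrt_def)

lemma esqrt_ennreal: "0 \<le> a \<Longrightarrow> esqrt (ennreal a) = ennreal (sqrt a)"
  by (simp add: esqrt_def)

lemma esqrt_mono: "a \<le> b \<Longrightarrow> esqrt a \<le> esqrt b"
  by (cases a; cases b) (auto simp: esqrt_ennreal ennreal_leI top_unique)

lemma borel_measurable_esqrt [measurable]: "esqrt \<in> borel_measurable borel"
  unfolding esqrt_def[abs_def] by measurable

text \<open>The arithmetic-geometric mean inequality for t a b and 1 / (t b), whose product is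
  \<open>a\<close>. If \<open>b\<close> is 0 or \<open>\<top>\<close> and \<open>a\<close> is not 0,
  the right side is infinite under the conventions of \<open>ennreal\<close>. Integrating this and
  then choosing \<open>t\<close> yields Cauchy-Schwarz without any integrability hypothesis.\<close>

lemma esqrt_amgm:
  assumes "0 < t"
  shows "2 * esqrt a \<le> ennreal t * (a * b) + ennreal (1 / t) * (1 / b)"
proof (cases a)
  case (real x)
  show ?thesis
  proof (cases b)
    case (real y)
    show ?thesis
    proof (cases "y = 0")
      case True
      then show ?thesis using assms real by (simp add: ennreal_mult_top)
    next
      case False
      have 1: "2 * sqrt x \<le> t * (x * y) + 1 / t * (1 / y)"
      proof -
        have "0 \<le> (sqrt (t * x * y) - sqrt (1 / (t * y)))\<^sup>2" by simp
        also have "\<dots> = t * x * y + 1 / (t * y) - 2 * (sqrt (t * x * y) * sqrt (1 / (t * y)))"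
          using assms real \<open>a = ennreal x\<close> \<open>0 \<le> x\<close> by (simp add: power2_diff)
        also have "sqrt (t * x * y) * sqrt (1 / (t * y)) = sqrt x"
          using assms real False by (simp flip: real_sqrt_mult)
        finally show ?thesis by (simp add: ac_simps)
      qed
      have "2 * esqrt a = ennreal (2 * sqrt x)"
        using \<open>a = ennreal x\<close> \<open>0 \<le> x\<close> by (simp add: esqrt_ennreal ennreal_mult)
      also have "\<dots> \<le> ennreal (t * (x * y) + 1 / t * (1 / y))"
        using 1 by (rule ennreal_leI)
      also have "\<dots> = ennreal t * (a * b) + ennreal (1 / t) * ennreal (1 / y)"
      proof -
        have nn: "0 \<le> t" "0 \<le> x * y" "0 \<le> 1 / t" "0 \<le> 1 / y" "0 \<le> t * (x * y)" "0 \<le> 1 / t * (1 / y)"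
          using assms real \<open>0 \<le> x\<close> by auto
        show ?thesis
          unfolding ennreal_plus[OF nn(5,6)] ennreal_mult[OF nn(1,2)] ennreal_mult[OF nn(3,4)]
            ennreal_mult[OF \<open>0 \<le> x\<close> \<open>0 \<le> y\<close>] by (simp add: \<open>a = ennreal x\<close> \<open>b = ennreal y\<close>)
      qed
      also have "ennreal (1 / y) = 1 / b"
        using real False by (simp add: divide_ennreal[symmetric])
      finally show ?thesis .
    qed
  next
    case top
    show ?thesis
    proof (cases "x = 0")
      case True
      then show ?thesis using real by (simp add: esqrt_ennreal)
    next
      case False
      then show ?thesis using real top assms by (simp add: ennreal_mult_top)
    qed
  qed
next
  case top
  then show ?thesis
    using assms by (cases "b = 0") (auto simp: ennreal_mult_top ennreal_top_mult)
qed

lemma nn_integral_esqrt_le: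
  assumes [measurable]: "a \<in> borel_measurable M" "b \<in> borel_measurable M"
    and D: "(\<integral>\<^sup>+q. a q * b q \<partial>M) \<le> ennreal D" "0 < D"
    and r: "(\<integral>\<^sup>+q. 1 / b q \<partial>M) \<le> ennreal r" "0 < r"
  shows "(\<integral>\<^sup>+q. esqrt (a q) \<partial>M) \<le> ennreal (sqrt (r * D))"
proof -
  \<comment> \<open>The minimiser of t D + r / t, with minimum 2 sqrt (r D).\<close>
  define t where "t = sqrt (r / D)"
  have t: "0 < t" using D r by (simp add: t_def)
  have "2 * (\<integral>\<^sup>+q. esqrt (a q) \<partial>M) = (\<integral>\<^sup>+q. 2 * esqrt (a q) \<partial>M)"
    by (intro nn_integral_cmult[symmetric]) measurable
  also have "\<dots> \<le> (\<integral>\<^sup>+q. ennreal t * (a q * b q) + ennreal (1 / t) * (1 / b q) \<partial>M)"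
    by (intro nn_integral_mono esqrt_amgm t)
  also have "\<dots> = ennreal t * (\<integral>\<^sup>+q. a q * b q \<partial>M) + ennreal (1 / t) * (\<integral>\<^sup>+q. 1 / b q \<partial>M)"
    by (simp add: nn_integral_add nn_integral_cmult)
  also have "\<dots> \<le> ennreal t * ennreal D + ennreal (1 / t) * ennreal r"
    using D r by (intro add_mono mult_left_mono) auto
  also have "\<dots> = ennreal (t * D + 1 / t * r)"
  proof -
    have nn: "0 \<le> t" "0 \<le> D" "0 \<le> 1 / t" "0 \<le> r" "0 \<le> t * D" "0 \<le> 1 / t * r"
      using t D r by auto
    show ?thesis
      unfolding ennreal_plus[OF nn(5,6)] ennreal_mult[OF nn(1,2)] ennreal_mult[OF nn(3,4)] ..
  qed
  also have "t * D + 1 / t * r = 2 * sqrt (r * D)"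
  proof -
    have "t * D = sqrt (r * D)"
      using D r by (simp add: t_def real_sqrt_divide real_sqrt_mult real_div_sqrt field_simps)
    moreover have "1 / t * r = sqrt (r * D)"
      using D r by (simp add: t_def real_sqrt_divide real_sqrt_mult real_div_sqrt field_simps)
    ultimately show ?thesis by simp
  qed
  also have "ennreal (2 * sqrt (r * D)) = 2 * ennreal (sqrt (r * D))"
    using D r by (simp add: ennreal_mult)
  finally show ?thesis
    by (subst (asm) ennreal_mult_le_mult_iff) auto
qed

section \<open>The growth model\<close>

locale growth_model =
  fixes p :: "'s::finite \<Rightarrow> 's \<Rightarrow> real"
    and \<nu> :: "real measure"
    and \<beta> \<gamma> :: real
    and u :: "real \<Rightarrow> real"
    and f :: "'s \<Rightarrow> real \<Rightarrow> real \<Rightarrow> real"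
    and w V \<phi> :: "real \<Rightarrow> 's \<Rightarrow> real"
  assumes p: "stochastic_matrix p"
    and \<nu>: "prob_space \<nu>" "sets \<nu> = sets halfline"
    and \<beta>: "0 < \<beta>" "\<beta> < 1"
    and \<gamma>: "0 < \<gamma>"
    and f_nonneg: "\<And>\<theta> y z. 0 \<le> y \<Longrightarrow> 0 \<le> z \<Longrightarrow> 0 \<le> f \<theta> y z"
    and U1: "strictly_concave_on {0..} u" "strict_mono_on {0..} u" "u 0 = 0"
    and U3: "u C1_differentiable_on {0<..}"
    and U4: "filterlim (\<lambda>h. (u (0 + h) - u 0) / h) at_top (at_right 0)"
    and f_mono: "\<And>\<theta> z. 0 \<le> z \<Longrightarrow> mono_on {0..} (\<lambda>y. f \<theta> y z)"
    and f_cont: "\<And>\<theta> z. 0 \<le> z \<Longrightarrow> continuous_on {0..} (\<lambda>y. f \<theta> y z)"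
    and f_concave: "\<And>\<theta> z. 0 \<le> z \<Longrightarrow> concave_on {0..} (\<lambda>y. f \<theta> y z)"
    and f_meas: "\<And>\<theta> y. 0 \<le> y \<Longrightarrow> f \<theta> y \<in> borel_measurable halfline"
    and F3: "\<And>\<theta> z. 0 \<le> z \<Longrightarrow> (\<lambda>y. f \<theta> y z) C1_differentiable_on {0<..}"
    and F4: "\<And>\<theta> z. 0 \<le> z \<Longrightarrow> f \<theta> 0 z = 0"
    and D1: "\<exists>L<1. ((\<lambda>y. MAX \<theta>. \<integral>\<^sup>+ z. 1 / ennreal (\<beta> * deriv (\<lambda>y. f \<theta> y z) y) \<partial>\<nu>)
               \<longlongrightarrow> L) (at_right 0)"
    and D2: "\<exists>l2>0. l2 < 1 \<and> (\<exists>\<kappa>2>0. \<forall>y\<ge>0.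
               (MAX \<theta>. \<integral>\<^sup>+ z. ennreal (f \<theta> y z) \<partial>\<nu>) \<le> ennreal (l2 * y + \<kappa>2))"
    and V: "is_value_function p \<nu> \<beta> \<gamma> u f w V"
    and \<phi>: "is_optimal_policy p \<nu> \<beta> \<gamma> u f V \<phi>"
begin

sublocale \<nu>: prob_space \<nu> by (rule \<nu>)

lemma space_\<nu>: "space \<nu> = {0..}"
  using sets_eq_imp_space_eq[OF \<nu>(2)] by (simp add: space_restrict_space)

lemma p_nonneg: "0 \<le> p i j" and p_sum: "(\<Sum>j\<in>UNIV. p i j) = 1"
  using p by (auto simp: stochastic_matrix_def)

lemma V_mono: "mono_on {0..} (\<lambda>x. V x \<theta>)"
  and V_nonneg: "0 \<le> x \<Longrightarrow> 0 \<le> V x \<theta>"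
  and V_cont: "continuous_on {0..} (\<lambda>x. V x \<theta>)"
  and V_concave: "concave_on {0..} (\<lambda>x. V x \<theta>)"
  using V by (auto simp: is_value_function_def value_space_def)

lemma \<phi>_nonneg: "0 \<le> x \<Longrightarrow> 0 \<le> \<phi> x \<theta>" and \<phi>_le: "0 \<le> x \<Longrightarrow> \<phi> x \<theta> \<le> x"
  and \<phi>_meas: "(\<lambda>(x, \<theta>). \<phi> x \<theta>) \<in> borel_measurable state_space"
  using \<phi> by (auto simp: is_optimal_policy_def policy_space_def)

text \<open>The joint law of the shock and the next regime. It does not depend on income, so chains
  started from different incomes can share one draw, and monotonicity and continuity in income can
  be checked draw by draw.\<close>

definition shock :: "'s \<Rightarrow> (real \<times> 's) measure" where
  "shock \<theta> = \<nu> \<Otimes>\<^sub>M point_measure UNIV (\<lambda>j. ennreal (p \<theta> j))"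

lemma prob_space_regime: "prob_space (point_measure UNIV (\<lambda>j. ennreal (p \<theta> j)))"
  by (rule prob_spaceI)
    (simp add: space_point_measure emeasure_point_measure_finite p_sum p_nonneg)

lemma prob_space_shock: "prob_space (shock \<theta>)"
proof -
  interpret R: prob_space "point_measure UNIV (\<lambda>j. ennreal (p \<theta> j))" by (rule prob_space_regime)
  interpret pair_prob_space \<nu> "point_measure UNIV (\<lambda>j. ennreal (p \<theta> j))" ..
  show ?thesis unfolding shock_def by unfold_locales
qed

lemma sets_shock: "sets (shock \<theta>) = sets (\<nu> \<Otimes>\<^sub>M count_space UNIV)"
  unfolding shock_def by (intro sets_pair_measure_cong) (auto simp: sets_point_measure)

lemma sets_shock_state: "sets (shock \<theta>) = sets state_space"
  unfolding sets_shock by (intro sets_pair_measure_cong) (auto simp: \<nu>(2))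

lemma space_shock: "space (shock \<theta>) = {0..} \<times> UNIV"
  using sets_eq_imp_space_eq[OF sets_shock_state] by (simp add: space_state_space)

lemma nn_integral_shock:
  assumes h: "h \<in> borel_measurable (shock \<theta>)"
  shows "(\<integral>\<^sup>+q. h q \<partial>shock \<theta>) = (\<integral>\<^sup>+z. (\<Sum>j\<in>UNIV. ennreal (p \<theta> j) * h (z, j)) \<partial>\<nu>)"
proof -
  interpret R: prob_space "point_measure UNIV (\<lambda>j. ennreal (p \<theta> j))" by (rule prob_space_regime)
  show ?thesis
    unfolding shock_def using R.nn_integral_fst[OF h[unfolded shock_def]]
    by (simp add: nn_integral_point_measure_finite)
qed

lemma nn_integral_shock_fst:
  assumes h: "h \<in> borel_measurable \<nu>"
  shows "(\<integral>\<^sup>+q. h (fst q) \<partial>shock \<theta>) = (\<integral>\<^sup>+z. h z \<partial>\<nu>)"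
proof -
  have m: "(\<lambda>q. h (fst q)) \<in> borel_measurable (shock \<theta>)"
    using h unfolding shock_def by measurable
  have "(\<Sum>j\<in>UNIV. ennreal (p \<theta> j)) = 1"
    by (simp add: p_nonneg p_sum)
  then show ?thesis
    by (simp add: nn_integral_shock[OF m] sum_distrib_right[symmetric])
qed

lemma integral_shock:
  fixes h :: "real \<times> 's \<Rightarrow> real"
  assumes h: "integrable (shock \<theta>) h" and int: "\<And>j. integrable \<nu> (\<lambda>z. h (z, j))"
  shows "(\<integral>q. h q \<partial>shock \<theta>) = (\<Sum>j\<in>UNIV. p \<theta> j * (\<integral>z. h (z, j) \<partial>\<nu>))"
proof -
  interpret R: prob_space "point_measure UNIV (\<lambda>j. ennreal (p \<theta> j))" by (rule prob_space_regime)
  interpret pair_prob_space \<nu> "point_measure UNIV (\<lambda>j. ennreal (p \<theta> j))" ..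
  have "(\<integral>q. h q \<partial>shock \<theta>) = (\<integral>z. (\<Sum>j\<in>UNIV. p \<theta> j * h (z, j)) \<partial>\<nu>)"
    unfolding shock_def integral_fst'[OF h[unfolded shock_def], symmetric]
    by (simp add: lebesgue_integral_point_measure_finite p_nonneg)
  also have "\<dots> = (\<Sum>j\<in>UNIV. p \<theta> j * (\<integral>z. h (z, j) \<partial>\<nu>))"
    using int by (subst Bochner_Integration.integral_sum) auto
  finally show ?thesis .
qed

definition next_state :: "'s \<Rightarrow> real \<Rightarrow> real \<times> 's \<Rightarrow> real \<times> 's" where
  "next_state \<theta> y q = (f \<theta> y (fst q), snd q)"

lemma next_state_measurable:
  assumes "0 \<le> y"
  shows "next_state \<theta> y \<in> shock \<theta>' \<rightarrow>\<^sub>M state_space"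
proof -
  have fm: "f \<theta> y \<in> \<nu> \<rightarrow>\<^sub>M halfline"
    unfolding measurable_cong_sets[OF \<nu>(2) refl]
    using f_meas[OF assms] f_nonneg[OF assms] by (intro measurable_restrict_space2) (auto simp: space_restrict_space)
  have "(\<lambda>q. f \<theta> y (fst q)) \<in> \<nu> \<Otimes>\<^sub>M count_space UNIV \<rightarrow>\<^sub>M halfline"
    using measurable_compose[OF measurable_fst fm] .
  then have "(\<lambda>q. (f \<theta> y (fst q), snd q)) \<in> \<nu> \<Otimes>\<^sub>M count_space UNIV \<rightarrow>\<^sub>M state_space"
    by (rule measurable_Pair[OF _ measurable_snd])
  then show ?thesis
    unfolding measurable_cong_sets[OF sets_shock refl] next_state_def .
qed

lemma income_kernel_eq:
  "income_kernel p \<nu> f \<phi> (x, \<theta>) = distr (shock \<theta>) state_space (next_state \<theta> (\<phi> x \<theta>))"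
  by (simp add: income_kernel_def shock_def next_state_def[abs_def] split_beta')

lemma measurable_state_spaceI:
  fixes g :: "real \<Rightarrow> 's \<Rightarrow> 'a::topological_space"
  assumes "\<And>j. (\<lambda>x. g x j) \<in> borel_measurable halfline"
  shows "(\<lambda>(x, j). g x j) \<in> borel_measurable state_space"
  unfolding split_beta'
  by (rule measurable_compose_countable[where f="\<lambda>j s. g (fst s) j" and g=snd])
     (auto intro: measurable_compose[OF measurable_fst assms])

lemma V_meas: "(\<lambda>(x, j). V x j) \<in> borel_measurable state_space"
  by (intro measurable_state_spaceI borel_measurable_continuous_on_restrict V_cont)

definition disc :: "real \<times> 's \<Rightarrow> real" where
  "disc s = exp (- \<gamma> * V (fst s) (snd s))"

lemma disc_meas: "disc \<in> borel_measurable state_space"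
  using V_meas unfolding disc_def[abs_def] split_beta' by measurable

lemma disc_bounds: "0 < disc s" "0 \<le> fst s \<Longrightarrow> disc s \<le> 1"
  using V_nonneg \<gamma> by (auto simp: disc_def)

lemma next_state_nonneg: "0 \<le> y \<Longrightarrow> q \<in> space (shock \<theta>') \<Longrightarrow> 0 \<le> fst (next_state \<theta> y q)"
  by (auto simp: space_shock next_state_def f_nonneg)

lemma integrable_disc: "0 \<le> y \<Longrightarrow> integrable (shock \<theta>') (\<lambda>q. disc (next_state \<theta> y q))"
proof -
  assume y: "0 \<le> y"
  interpret prob_space "shock \<theta>'" by (rule prob_space_shock)
  show ?thesis
    using y disc_bounds next_state_nonneg[OF y] measurable_compose[OF next_state_measurable[OF y] disc_meas]
    by (intro integrable_const_bound[of _ 1] AE_I2) (auto simp: abs_of_pos)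
qed

definition H :: "'s \<Rightarrow> real \<Rightarrow> real" where
  "H \<theta> y = (\<integral>q. disc (next_state \<theta> y q) \<partial>shock \<theta>)"

lemma H_eq:
  assumes y: "0 \<le> y"
  shows "(\<Sum>\<theta>'\<in>UNIV. p \<theta> \<theta>' * (\<integral>z. exp (- \<gamma> * V (f \<theta> y z) \<theta>') \<partial>\<nu>)) = H \<theta> y"
proof -
  have "integrable \<nu> (\<lambda>z. exp (- \<gamma> * V (f \<theta> y z) j))" for j
  proof (rule \<nu>.integrable_const_bound[of _ 1])
    show "AE z in \<nu>. norm (exp (- \<gamma> * V (f \<theta> y z) j)) \<le> 1"
      using \<gamma> by (intro AE_I2) (simp add: space_\<nu> V_nonneg f_nonneg y)
    have "f \<theta> y \<in> \<nu> \<rightarrow>\<^sub>M halfline"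
      unfolding measurable_cong_sets[OF \<nu>(2) refl]
      using f_meas[OF y] f_nonneg[OF y] by (intro measurable_restrict_space2) (auto simp: space_restrict_space)
    from measurable_compose[OF this borel_measurable_continuous_on_restrict[OF V_cont]]
    show "(\<lambda>z. exp (- \<gamma> * V (f \<theta> y z) j)) \<in> borel_measurable \<nu>" by measurable
  qed
  then show ?thesis
    unfolding H_def by (subst integral_shock[OF integrable_disc[OF y]]) (auto simp: next_state_def disc_def)
qed

lemma H_pos: "0 \<le> y \<Longrightarrow> 0 < H \<theta> y"
  and H_le_1: "0 \<le> y \<Longrightarrow> H \<theta> y \<le> 1"
proof -
  assume y: "0 \<le> y"
  interpret prob_space "shock \<theta>" by (rule prob_space_shock)
  have "H \<theta> y \<le> (\<integral>q. 1 \<partial>shock \<theta>)"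
    unfolding H_def using y disc_bounds next_state_nonneg[OF y]
    by (intro integral_mono integrable_disc) auto
  then show "H \<theta> y \<le> 1" by (simp add: prob_space)
  have "H \<theta> y \<noteq> 0"
  proof
    assume "H \<theta> y = 0"
    then have "AE q in shock \<theta>. disc (next_state \<theta> y q) = 0"
      unfolding H_def
      using integral_nonneg_eq_0_iff_AE[OF integrable_disc[OF y]] less_imp_le[OF disc_bounds(1)] by auto
    then have "AE q in shock \<theta>. False"
      by eventually_elim (metis disc_bounds(1) less_irrefl)
    then show False by simp
  qed
  moreover have "0 \<le> H \<theta> y"
    unfolding H_def using less_imp_le[OF disc_bounds(1)] by (intro Bochner_Integration.integral_nonneg) auto
  ultimately show "0 < H \<theta> y" by simp
qed

lemma H_antimono: "0 \<le> y \<Longrightarrow> y \<le> y' \<Longrightarrow> H \<theta> y' \<le> H \<theta> y"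
proof -
  assume y: "0 \<le> y" "y \<le> y'"
  show ?thesis
    unfolding H_def
  proof (intro integral_mono integrable_disc)
    fix q assume "q \<in> space (shock \<theta>)"
    then obtain z j where q: "q = (z, j)" "0 \<le> z" by (auto simp: space_shock)
    have "f \<theta> y z \<le> f \<theta> y' z"
      using mono_onD[OF f_mono[OF q(2)]] y by auto
    then have "V (f \<theta> y z) j \<le> V (f \<theta> y' z) j"
      using mono_onD[OF V_mono] f_nonneg q(2) y by auto
    then show "disc (next_state \<theta> y' q) \<le> disc (next_state \<theta> y q)"
      using \<gamma> by (simp add: disc_def next_state_def q)
  qed (use y in auto)
qed

lemma objective_eq:
  "0 \<le> y \<Longrightarrow> bellman_objective p \<nu> \<beta> \<gamma> u f V x \<theta> y = u (x - y) - \<beta> / \<gamma> * ln (H \<theta> y)"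
  unfolding bellman_objective_def by (simp only: H_eq)

lemma u_mono: "0 \<le> a \<Longrightarrow> a \<le> b \<Longrightarrow> u a \<le> u b"
  using strict_mono_onD[OF U1(2), of a b] by (cases "a = b") auto

lemma V_eq_SUP:
  assumes "0 \<le> x"
  shows "V x \<theta> = (SUP y\<in>{0..x}. bellman_objective p \<nu> \<beta> \<gamma> u f V x \<theta> y)"
  using V[unfolded is_value_function_def, THEN conjunct2, rule_format, OF assms] .

lemma objective_\<phi>:
  assumes "0 \<le> x"
  shows "bellman_objective p \<nu> \<beta> \<gamma> u f V x \<theta> (\<phi> x \<theta>) =
    (SUP y\<in>{0..x}. bellman_objective p \<nu> \<beta> \<gamma> u f V x \<theta> y)"
  using \<phi>[unfolded is_optimal_policy_def, THEN conjunct2, rule_format, OF assms] .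

lemma V_ge_objective:
  assumes "0 \<le> y" "y \<le> x"
  shows "u (x - y) - \<beta> / \<gamma> * ln (H \<theta> y) \<le> V x \<theta>"
proof -
  \<comment> \<open>A real supremum dominates its members only for a bounded set; monotonicity of
    \<open>u\<close> and of \<open>H\<close> bounds the two terms of the objective
    separately.\<close>
  have bdd: "bdd_above ((\<lambda>y. bellman_objective p \<nu> \<beta> \<gamma> u f V x \<theta> y) ` {0..x})"
  proof (rule bdd_aboveI2[where M="u x - \<beta> / \<gamma> * ln (H \<theta> x)"])
    fix y assume y: "y \<in> {0..x}"
    have "u (x - y) \<le> u x" using y by (intro u_mono) auto
    moreover have "ln (H \<theta> x) \<le> ln (H \<theta> y)"
      using y H_pos[of x \<theta>] H_antimono[of y x \<theta>] by (intro ln_mono) auto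
    then have "\<beta> / \<gamma> * ln (H \<theta> x) \<le> \<beta> / \<gamma> * ln (H \<theta> y)"
      using \<beta> \<gamma> by (intro mult_left_mono) auto
    ultimately show "bellman_objective p \<nu> \<beta> \<gamma> u f V x \<theta> y \<le> u x - \<beta> / \<gamma> * ln (H \<theta> x)"
      using y by (simp add: objective_eq)
  qed
  have "u (x - y) - \<beta> / \<gamma> * ln (H \<theta> y) = bellman_objective p \<nu> \<beta> \<gamma> u f V x \<theta> y"
    by (rule objective_eq[OF assms(1), symmetric])
  also have "\<dots> \<le> (SUP y\<in>{0..x}. bellman_objective p \<nu> \<beta> \<gamma> u f V x \<theta> y)"
    using assms bdd by (intro cSUP_upper) auto
  finally show ?thesis unfolding V_eq_SUP[OF order_trans[OF assms], symmetric] .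
qed

lemma V_eq_objective:
  assumes "0 \<le> x"
  shows "V x \<theta> = u (x - \<phi> x \<theta>) - \<beta> / \<gamma> * ln (H \<theta> (\<phi> x \<theta>))"
  by (rule trans[OF trans[OF V_eq_SUP[OF assms] objective_\<phi>[OF assms, symmetric]]
        objective_eq[OF \<phi>_nonneg[OF assms]]])

text \<open>At zero income both consumption and next income vanish, so \<open>V 0\<close> is at most
  \<beta> times its own maximum over the regimes, and discounting forces that maximum down to
  0.\<close>

lemma V_0: "V 0 \<theta> = 0"
proof -
  define m where "m = (MAX \<theta>. V 0 \<theta>)"
  have m: "V 0 \<theta> \<le> m" for \<theta> by (simp add: m_def)
  have "V 0 \<theta> \<le> \<beta> * m" for \<theta>
  proof -
    interpret prob_space "shock \<theta>" by (rule prob_space_shock)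
    have "exp (- \<gamma> * m) = (\<integral>q. exp (- \<gamma> * m) \<partial>shock \<theta>)"
      by (simp add: prob_space)
    also have "\<dots> \<le> H \<theta> 0"
      unfolding H_def
    proof (intro integral_mono integrable_disc)
      fix q assume "q \<in> space (shock \<theta>)"
      then show "exp (- \<gamma> * m) \<le> disc (next_state \<theta> 0 q)"
        using m \<gamma> F4 by (auto simp: disc_def next_state_def space_shock)
    qed auto
    finally have "- \<gamma> * m \<le> ln (H \<theta> 0)"
      using H_pos[of 0 \<theta>] by (simp add: ln_ge_iff)
    then have "\<beta> / \<gamma> * (- \<gamma> * m) \<le> \<beta> / \<gamma> * ln (H \<theta> 0)"
      using \<beta> \<gamma> by (intro mult_left_mono) auto
    moreover have "\<phi> 0 \<theta> = 0" using \<phi>_nonneg[of 0 \<theta>] \<phi>_le[of 0 \<theta>] by simp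
    ultimately show ?thesis
      using V_eq_objective[of 0 \<theta>] U1(3) \<gamma> by simp
  qed
  then have "m \<le> \<beta> * m"
    unfolding m_def by (subst Max_le_iff) auto
  then have "(1 - \<beta>) * m \<le> 0" by (simp add: algebra_simps)
  then have "m \<le> 0" using \<beta> by (simp add: mult_le_0_iff)
  then show ?thesis using m[of \<theta>] V_nonneg[of 0 \<theta>] by simp
qed

lemma H_0: "H \<theta> 0 = 1"
proof -
  interpret prob_space "shock \<theta>" by (rule prob_space_shock)
  have "H \<theta> 0 = (\<integral>q. 1 \<partial>shock \<theta>)"
    unfolding H_def by (intro Bochner_Integration.integral_cong) (auto simp: disc_def next_state_def space_shock F4 V_0)
  then show ?thesis by (simp add: prob_space)
qed

text \<open>Consume everything: zero investment contributes nothing, since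
  \<open>H \<theta> 0 = 1\<close>.\<close>

lemma V_ge_u: "0 \<le> x \<Longrightarrow> u x \<le> V x \<theta>"
  using V_ge_objective[of 0 x \<theta>] by (simp add: H_0)

end

section \<open>Concavity under integration and composition; limits of quotients\<close>

lemma strictly_concave_imp_concave:
  assumes "strictly_concave_on A g"
  shows "concave_on A g"
proof (rule concave_on_linorderI)
  fix t x y :: real assume "t > 0" "t < 1" "x \<in> A" "y \<in> A" "x < y"
  then show "(1 - t) * g x + t * g y \<le> g ((1 - t) *\<^sub>R x + t *\<^sub>R y)"
    using assms unfolding strictly_concave_on_def by (auto intro: less_imp_le)
qed (use assms in \<open>simp add: strictly_concave_on_def\<close>)

lemma C1_differentiable_on_has_real_derivative:
  fixes g :: "real \<Rightarrow> real"
  assumes "g C1_differentiable_on S" "x \<in> S"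
  shows "(g has_real_derivative deriv g x) (at x)"
  using assms unfolding C1_differentiable_on_def has_real_derivative_iff_has_vector_derivative[symmetric]
  by (metis DERIV_imp_deriv)

lemma concave_on_integral:
  assumes F: "\<And>z. z \<in> space M \<Longrightarrow> concave_on {0..} (\<lambda>y. F y z)"
    and int: "\<And>y. 0 \<le> y \<Longrightarrow> integrable M (F y :: _ \<Rightarrow> real)"
  shows "concave_on {0..} (\<lambda>y::real. \<integral>z. F y z \<partial>M)"
proof (rule concave_on_linorderI)
  fix t x y :: real assume t: "t > 0" "t < 1" "x \<in> {0..}" "y \<in> {0..}" "x < y"
  have "(1 - t) * (\<integral>z. F x z \<partial>M) + t * (\<integral>z. F y z \<partial>M) = (\<integral>z. (1 - t) * F x z + t * F y z \<partial>M)"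
    using t int by simp
  also have "\<dots> \<le> (\<integral>z. F ((1 - t) *\<^sub>R x + t *\<^sub>R y) z \<partial>M)"
  proof (intro integral_mono)
    fix z assume "z \<in> space M"
    then show "(1 - t) * F x z + t * F y z \<le> F ((1 - t) *\<^sub>R x + t *\<^sub>R y) z"
      using t by (intro concave_onD[OF F]) auto
  qed (use t int in auto)
  finally show "(1 - t) * (\<integral>z. F x z \<partial>M) + t * (\<integral>z. F y z \<partial>M) \<le> (\<integral>z. F ((1 - t) *\<^sub>R x + t *\<^sub>R y) z \<partial>M)" .
qed simp

lemma concave_on_comp_mono:
  fixes g f :: "real \<Rightarrow> real"
  assumes g: "concave_on {0..} g" "mono_on {0..} g" and f: "concave_on {0..} f" "\<And>y. 0 \<le> y \<Longrightarrow> 0 \<le> f y"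
  shows "concave_on {0..} (\<lambda>y. g (f y))"
proof (rule concave_on_linorderI)
  fix t x y :: real assume t: "t > 0" "t < 1" "x \<in> {0..}" "y \<in> {0..}" "x < y"
  have "(1 - t) * g (f x) + t * g (f y) \<le> g ((1 - t) *\<^sub>R f x + t *\<^sub>R f y)"
    using t f by (intro concave_onD[OF g(1)]) auto
  also have "\<dots> \<le> g (f ((1 - t) *\<^sub>R x + t *\<^sub>R y))"
    using t f concave_onD[OF f(1), of t x y] by (intro mono_onD[OF g(2)]) auto
  finally show "(1 - t) * g (f x) + t * g (f y) \<le> g (f ((1 - t) *\<^sub>R x + t *\<^sub>R y))" .
qed simp

lemma right_deriv_eqI_LIMSEQ:
  assumes g: "concave_on {0..} g" "0 \<le> x"
  shows "(\<lambda>n. ennreal (real (Suc n) * (g (x + 1 / real (Suc n)) - g x))) \<longlonglongrightarrow> right_deriv g x"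
  unfolding right_deriv_def
  using incseqD[OF incseq_right_quotients[OF g]] by (intro LIMSEQ_SUP) (auto simp: incseq_def intro!: ennreal_leI)

lemma LIMSEQ_left_quotients:
  fixes g :: "real \<Rightarrow> real"
  assumes "(g has_real_derivative D) (at x)"
  shows "(\<lambda>n. real (Suc n) * (g x - g (x - 1 / real (Suc n)))) \<longlonglongrightarrow> D"
proof -
  have "(\<lambda>n. - (1 / real (Suc n))) \<longlonglongrightarrow> - 0"
    by (intro tendsto_minus LIMSEQ_Suc[OF lim_1_over_n])
  then have "filterlim (\<lambda>n. - (1 / real (Suc n))) (at 0) sequentially"
    by (intro filterlim_atI) auto
  with assms have "(\<lambda>n. (g (x + - (1 / real (Suc n))) - g x) / - (1 / real (Suc n))) \<longlonglongrightarrow> D"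
    unfolding DERIV_def by (rule filterlim_compose)
  moreover have "(g (x + - (1 / real (Suc n))) - g x) / - (1 / real (Suc n)) = real (Suc n) * (g x - g (x - 1 / real (Suc n)))" for n
    by (simp add: field_simps)
  ultimately show ?thesis by simp
qed

text \<open>The outermost function in the composition with value and production to which the chain
  rule is applied; \<open>exp (- \<gamma> * t)\<close> itself is decreasing and convex, hence the
  complement to 1.\<close>

lemma utility_loss:
  fixes \<gamma> :: real
  assumes "0 < \<gamma>"
  shows "concave_on {0..} (\<lambda>t. 1 - exp (- \<gamma> * t))" "mono_on {0..} (\<lambda>t. 1 - exp (- \<gamma> * t))"
    and "\<And>t. 0 \<le> t \<Longrightarrow> ennreal (\<gamma> * exp (- \<gamma> * t)) \<le> right_deriv (\<lambda>t. 1 - exp (- \<gamma> * t)) t"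
proof -
  have "convex_on UNIV (\<lambda>t. exp (- \<gamma> * t))"
  proof (rule f''_ge0_imp_convex)
    show "((\<lambda>t. exp (- \<gamma> * t)) has_real_derivative (- \<gamma> * exp (- \<gamma> * t))) (at t)" for t
      by (auto intro!: derivative_eq_intros)
    show "((\<lambda>t. - \<gamma> * exp (- \<gamma> * t)) has_real_derivative (\<gamma>\<^sup>2 * exp (- \<gamma> * t))) (at t)" for t
      by (auto intro!: derivative_eq_intros simp: power2_eq_square)
  qed auto
  then have "convex_on {0..} (\<lambda>t. exp (- \<gamma> * t))"
    by (rule convex_on_subset) auto
  then show c: "concave_on {0..} (\<lambda>t. 1 - exp (- \<gamma> * t))"
    by (intro concave_on_diff) (auto simp: concave_on_const)
  show "mono_on {0..} (\<lambda>t. 1 - exp (- \<gamma> * t))"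
    using assms by (auto intro!: mono_onI)
  fix t :: real assume "0 \<le> t"
  moreover have "((\<lambda>t. 1 - exp (- \<gamma> * t)) has_real_derivative (\<gamma> * exp (- \<gamma> * t))) (at t)"
    by (auto intro!: derivative_eq_intros)
  ultimately show "ennreal (\<gamma> * exp (- \<gamma> * t)) \<le> right_deriv (\<lambda>t. 1 - exp (- \<gamma> * t)) t"
    by (intro right_deriv_ge_deriv[OF c])
qed

section \<open>Envelope relation and monotone policies\<close>

context growth_model
begin

lemma u_concave: "concave_on {0..} u"
  using U1(1) by (rule strictly_concave_imp_concave)

lemma u_strict:
  assumes "0 \<le> a" "0 \<le> b" "a \<noteq> b" "0 < t" "t < 1"
  shows "(1 - t) * u a + t * u b < u ((1 - t) * a + t * b)"
  using U1(1) assms by (simp add: strictly_concave_on_def)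

lemma u_deriv: "0 < a \<Longrightarrow> (u has_real_derivative deriv u a) (at a)"
  using C1_differentiable_on_has_real_derivative[OF U3] by simp

lemma f_deriv: "0 \<le> z \<Longrightarrow> 0 < y \<Longrightarrow> ((\<lambda>y. f \<theta> y z) has_real_derivative deriv (\<lambda>y. f \<theta> y z) y) (at y)"
  using C1_differentiable_on_has_real_derivative[OF F3] by simp

abbreviation c :: "real \<Rightarrow> 's \<Rightarrow> real" where
  "c x \<theta> \<equiv> x - \<phi> x \<theta>"

definition D :: "real \<Rightarrow> 's \<Rightarrow> ennreal" where
  "D x \<theta> = right_deriv (\<lambda>x. V x \<theta>) x"

lemma D_finite: "0 < x \<Longrightarrow> D x \<theta> < \<infinity>"
  unfolding D_def by (rule right_deriv_finite[OF V_concave])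

lemma D_antimono: "0 \<le> x \<Longrightarrow> x \<le> y \<Longrightarrow> D y \<theta> \<le> D x \<theta>"
  unfolding D_def by (rule right_deriv_antimono[OF V_concave])

text \<open>Keep the investment fixed and let consumption absorb the change \<open>h\<close> of
  income, of either sign as long as consumption stays nonnegative.\<close>

lemma V_diff_ge:
  assumes "0 \<le> x" "- c x \<theta> \<le> h"
  shows "u (c x \<theta> + h) - u (c x \<theta>) \<le> V (x + h) \<theta> - V x \<theta>"
  using V_ge_objective[of "\<phi> x \<theta>" "x + h" \<theta>] V_eq_objective[of x \<theta>] \<phi>_nonneg[of x \<theta>] assms
  by (simp add: algebra_simps)

lemma D_ge_u: "0 \<le> x \<Longrightarrow> right_deriv u (c x \<theta>) \<le> D x \<theta>"
  unfolding D_def right_deriv_def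
  using \<phi>_le V_diff_ge by (intro SUP_mono' ennreal_leI mult_left_mono) (auto simp: order_trans[of _ 0])

lemma right_deriv_u_0: "right_deriv u 0 = \<top>"
proof (rule ccontr)
  assume "right_deriv u 0 \<noteq> \<top>"
  then obtain r where r: "right_deriv u 0 = ennreal r" "0 \<le> r"
    by (cases "right_deriv u 0") auto
  have "\<forall>\<^sub>F h in at_right 0. r + 1 \<le> (u (0 + h) - u 0) / h"
    using U4 by (simp add: filterlim_at_top)
  moreover have "\<forall>\<^sub>F h in at_right 0. (0::real) < h"
    by (simp add: eventually_at_filter)
  ultimately have "\<forall>\<^sub>F h in at_right 0. 0 < h \<and> r + 1 \<le> (u (0 + h) - u 0) / h"
    by eventually_elim auto
  then obtain h where h: "0 < h" "r + 1 \<le> (u (0 + h) - u 0) / h"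
    using eventually_happens[of _ "at_right (0::real)"] by auto
  have "ennreal (r + 1) \<le> ennreal ((u (0 + h) - u 0) / h)"
    using h by (intro ennreal_leI)
  also have "\<dots> \<le> ennreal r"
    using right_deriv_ge_quotient[OF u_concave _ h(1), of 0] r by simp
  finally show False using r by simp
qed

lemma D_0: "D 0 \<theta> = \<top>"
proof -
  have "right_deriv u 0 \<le> D 0 \<theta>"
    using D_ge_u[of 0 \<theta>] \<phi>_le[of 0 \<theta>] \<phi>_nonneg[of 0 \<theta>] by simp
  then show ?thesis by (simp add: right_deriv_u_0 top_unique)
qed

text \<open>Zero consumption would pass the infinite slope of \<open>u\<close> at 0 on to
  \<open>V\<close>, but a concave function has finite slope at interior points.\<close>

lemma c_pos:
  assumes "0 < x"
  shows "0 < c x \<theta>"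
proof (rule ccontr)
  assume "\<not> 0 < c x \<theta>"
  then have "c x \<theta> = 0" using \<phi>_le[of x \<theta>] assms by simp
  then have "\<top> \<le> D x \<theta>"
    using D_ge_u[of x \<theta>] assms by (simp add: right_deriv_u_0)
  with D_finite[OF assms, of \<theta>] show False by simp
qed

lemma right_deriv_u: "0 < a \<Longrightarrow> right_deriv u a = ennreal (deriv u a)"
  by (rule right_deriv_eq_deriv[OF u_concave _ u_deriv])

text \<open>By \<open>V_diff_ge\<close>, \<open>V\<close> lies above a shifted copy of
  \<open>u\<close> and touches it at \<open>x\<close>. More income bounds the slope from below, less
  income bounds it from above, and differentiability of \<open>u\<close> at positive consumption
  closes the gap.\<close>

lemma D_eq:
  assumes "0 < x"
  shows "D x \<theta> = ennreal (deriv u (c x \<theta>))"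
proof (rule antisym)
  show "D x \<theta> \<le> ennreal (deriv u (c x \<theta>))"
  proof (rule le_deriv_of_left_quotients[OF u_deriv])
    fix h assume h: "0 < h" "h \<le> c x \<theta>"
    have "D x \<theta> \<le> ennreal ((V x \<theta> - V (x - h) \<theta>) / h)"
      unfolding D_def using h assms \<phi>_nonneg[of x \<theta>] by (intro right_deriv_le_quotient[OF V_concave]) auto
    also have "\<dots> \<le> ennreal ((u (c x \<theta>) - u (c x \<theta> - h)) / h)"
      using V_diff_ge[of x \<theta> "- h"] h assms by (intro ennreal_leI divide_right_mono) auto
    finally show "D x \<theta> \<le> ennreal ((u (c x \<theta>) - u (c x \<theta> - h)) / h)" .
  qed (use c_pos[OF assms] in auto)
  show "ennreal (deriv u (c x \<theta>)) \<le> D x \<theta>"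
    using D_ge_u[of x \<theta>] right_deriv_u[OF c_pos[OF assms, of \<theta>]] assms by simp
qed

lemma right_deriv_u_strict:
  assumes "0 \<le> a" "a < b"
  shows "right_deriv u b < right_deriv u a"
proof -
  \<comment> \<open>Half the interval: strict concavity at the midpoint separates the quotient over
    the left half, a lower bound for the slope at \<open>a\<close>, from the one over the right
    half, an upper bound for the slope at \<open>b\<close>.\<close>
  define h where "h = (b - a) / 2"
  have h: "0 < h" "a + h = b - h" "a + h = (1 - 1/2) * a + 1/2 * b"
    using assms by (auto simp: h_def field_simps)
  have "(1 - 1/2) * u a + 1/2 * u b < u ((1 - 1/2) * a + 1/2 * b)"
    using assms by (intro u_strict) auto
  then have m: "u b - u (b - h) < u (a + h) - u a"
    unfolding h(3)[symmetric] h(2)[symmetric] by simp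
  \<comment> \<open>\<open>ennreal\<close> truncates negative quotients, so strictness survives only
    if the larger one is positive.\<close>
  have "u (b - h) \<le> u b"
    using h assms by (intro u_mono) (auto simp: h_def field_simps)
  with m have pos: "0 < u (a + h) - u a" by linarith
  have "right_deriv u b \<le> ennreal ((u b - u (b - h)) / h)"
    using h assms by (intro right_deriv_le_quotient[OF u_concave]) (auto simp: h_def field_simps)
  also have "\<dots> < ennreal ((u (a + h) - u a) / h)"
    by (intro ennreal_lessI divide_strict_right_mono divide_pos_pos m pos h(1))
  also have "\<dots> \<le> right_deriv u a"
    using h assms by (intro right_deriv_ge_quotient[OF u_concave]) auto
  finally show ?thesis .
qed

text \<open>If consumption fell as income rises, the slope of \<open>u\<close> would strictly rise,
  and with it the slope of \<open>V\<close>, which concavity forbids.\<close>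

lemma c_mono:
  assumes "0 < x" "x \<le> y"
  shows "c x \<theta> \<le> c y \<theta>"
proof (rule ccontr)
  assume "\<not> c x \<theta> \<le> c y \<theta>"
  then have "right_deriv u (c x \<theta>) < right_deriv u (c y \<theta>)"
    using assms \<phi>_le[of y \<theta>] by (intro right_deriv_u_strict) auto
  also have "\<dots> \<le> D y \<theta>" using assms by (intro D_ge_u) auto
  also have "\<dots> \<le> D x \<theta>" using assms by (intro D_antimono) auto
  also have "\<dots> = right_deriv u (c x \<theta>)"
    using D_eq[OF assms(1), of \<theta>] right_deriv_u[OF c_pos[OF assms(1), of \<theta>]] by simp
  finally show False by simp
qed

text \<open>Strictly increasing differences of \<open>u (x - y)\<close> make the maximisers monotone.\<close>

lemma \<phi>_mono:
  assumes "0 \<le> x" "x \<le> x'"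
  shows "\<phi> x \<theta> \<le> \<phi> x' \<theta>"
proof (rule ccontr)
  define y where "y = \<phi> x \<theta>"
  define y' where "y' = \<phi> x' \<theta>"
  define a where "a = x - y"
  define d where "d = y - y'"
  define k where "k = x' - x"
  assume "\<not> \<phi> x \<theta> \<le> \<phi> x' \<theta>"
  then have yy: "y' < y" by (simp add: y_def y'_def)
  then have "x \<noteq> x'" by (auto simp: y_def y'_def)
  then have k: "0 < k" and d: "0 < d" using assms yy by (auto simp: k_def d_def)
  have y: "0 \<le> y'" "y \<le> x" "0 \<le> y"
    using \<phi>_nonneg[of x' \<theta>] \<phi>_nonneg[of x \<theta>] \<phi>_le[of x \<theta>] assms by (auto simp: y_def y'_def)
  then have a: "0 \<le> a" by (simp add: a_def)
  \<comment> \<open>Each optimal investment is tested against the other one; adding the two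
    inequalities cancels the terms in \<open>H\<close>.\<close>
  have "u (x - y') - \<beta> / \<gamma> * ln (H \<theta> y') \<le> u (x - y) - \<beta> / \<gamma> * ln (H \<theta> y)"
    using V_ge_objective[of y' x \<theta>] V_eq_objective[of x \<theta>] y yy assms by (simp add: y_def)
  moreover have "u (x' - y) - \<beta> / \<gamma> * ln (H \<theta> y) \<le> u (x' - y') - \<beta> / \<gamma> * ln (H \<theta> y')"
    using V_ge_objective[of y x' \<theta>] V_eq_objective[of x' \<theta>] y yy assms by (simp add: y'_def)
  ultimately have le: "u (a + d) + u (a + k) \<le> u a + u (a + d + k)"
    by (simp add: a_def d_def k_def algebra_simps)
  \<comment> \<open>The weight that makes \<open>a + d\<close> and \<open>a + k\<close> the two
    mirrored convex combinations of \<open>a\<close> and \<open>a + d + k\<close>.\<close>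
  define t where "t = d / (d + k)"
  have t: "0 < t" "t < 1" "t * (d + k) = d" using k d by (auto simp: t_def field_simps)
  have e: "(1 - t) * a + t * (a + d + k) = a + d" "(1 - t) * (a + d + k) + t * a = a + k"
    using t(3) by (auto simp: algebra_simps)
  have s: "(1 - t) * u v + t * u v' < u ((1 - t) * v + t * v')" if "0 \<le> v" "0 \<le> v'" "v \<noteq> v'" for v v'
    using t that by (intro u_strict)
  have "(1 - t) * u a + t * u (a + d + k) < u (a + d)"
    using s[of a "a + d + k"] a k d unfolding e by simp
  moreover have "(1 - t) * u (a + d + k) + t * u a < u (a + k)"
    using s[of "a + d + k" a] a k d unfolding e by simp
  ultimately show False using le by (simp add: algebra_simps)
qed

lemma \<phi>_continuous: "continuous_on {0<..} (\<lambda>x. \<phi> x \<theta>)"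
proof (rule lipschitz_on_continuous_on)
  show "1-lipschitz_on {0<..} (\<lambda>x. \<phi> x \<theta>)"
  proof (rule lipschitz_on_leI)
    fix x y :: real assume "x \<in> {0<..}" "y \<in> {0<..}" "x \<le> y"
    then show "dist (\<phi> x \<theta>) (\<phi> y \<theta>) \<le> 1 * dist x y"
      using \<phi>_mono[of x y \<theta>] c_mono[of x y \<theta>] by (auto simp: dist_real_def)
  qed simp
qed

section \<open>The Euler inequality\<close>

lemma f_meas_\<nu>: "0 \<le> y \<Longrightarrow> f \<theta> y \<in> borel_measurable \<nu>"
  using f_meas measurable_cong_sets[OF \<nu>(2) refl] by blast

lemma right_deriv_f_meas: "0 \<le> y \<Longrightarrow> (\<lambda>z. right_deriv (\<lambda>y. f \<theta> y z) y) \<in> borel_measurable \<nu>"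
proof -
  assume y: "0 \<le> y"
  have [measurable]: "f \<theta> y \<in> borel_measurable \<nu>" "f \<theta> (y + 1 / real (Suc n)) \<in> borel_measurable \<nu>" for n
    using y by (auto intro!: f_meas_\<nu>)
  show ?thesis
    unfolding right_deriv_def by measurable
qed

lemma D_meas: "(\<lambda>s. D (fst s) (snd s)) \<in> borel_measurable state_space"
proof -
  have "(\<lambda>x. D x j) \<in> borel_measurable halfline" for j
  proof -
    have [measurable]: "(\<lambda>x. V x j) \<in> borel_measurable halfline"
      by (intro borel_measurable_continuous_on_restrict V_cont)
    have [measurable]: "(\<lambda>x. V (x + 1 / real (Suc n)) j) \<in> borel_measurable halfline" for n
      by (intro borel_measurable_continuous_on_restrict continuous_on_compose2[OF V_cont])
         (auto intro!: continuous_intros)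
    show ?thesis unfolding D_def right_deriv_def by measurable
  qed
  then have "(\<lambda>(x, j). D x j) \<in> borel_measurable state_space"
    by (rule measurable_state_spaceI)
  then show ?thesis unfolding split_beta' .
qed

text \<open>Up to the factor \<gamma>, the slope of
  \<open>1 - exp (- \<gamma> * V x \<theta>)\<close> in income.\<close>

definition marginal :: "real \<times> 's \<Rightarrow> ennreal" where
  "marginal s = ennreal (disc s) * D (fst s) (snd s)"

lemma marginal_meas: "marginal \<in> borel_measurable state_space"
  using disc_meas D_meas unfolding marginal_def[abs_def] by measurable

lemma marginal_next_meas:
  "0 \<le> y \<Longrightarrow> (\<lambda>q. marginal (next_state \<theta> y q)) \<in> borel_measurable (shock \<theta>')"
  by (rule measurable_compose[OF next_state_measurable marginal_meas])

lemma right_deriv_f_shock_meas: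
  "0 \<le> y \<Longrightarrow> (\<lambda>q. right_deriv (\<lambda>y. f \<theta> y (fst q)) y) \<in> borel_measurable (shock \<theta>')"
  unfolding shock_def by (rule measurable_compose[OF measurable_fst right_deriv_f_meas])

text \<open>The first-order condition is only needed in the direction obtained from
  increasing the investment by \<open>1 / (n + 1)\<close>; monotone convergence does the rest.\<close>

lemma euler:
  fixes \<theta> :: 's
  assumes x: "0 < x"
  defines "y \<equiv> \<phi> x \<theta>"
  shows "ennreal \<beta> * (\<integral>\<^sup>+q. marginal (next_state \<theta> y q)
    * right_deriv (\<lambda>y. f \<theta> y (fst q)) y \<partial>shock \<theta>) \<le> D x \<theta>"
proof -
  interpret prob_space "shock \<theta>" by (rule prob_space_shock)
  have y: "0 \<le> y" using x by (simp add: y_def \<phi>_nonneg)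
  \<comment> \<open>Concave and non-decreasing in the investment, so slope and integral can be
    exchanged; its mean is \<open>1 - H\<close>.\<close>
  define F where "F y q = 1 - disc (next_state \<theta> y q)" for y q
  let ?U = "\<lambda>t. 1 - exp (- \<gamma> * t)"
  let ?I = "\<integral>\<^sup>+q. marginal (next_state \<theta> y q)
    * right_deriv (\<lambda>y. f \<theta> y (fst q)) y \<partial>shock \<theta>"
  have int: "integrable (shock \<theta>) (F y)" if "0 \<le> y" for y
    unfolding F_def using integrable_disc[OF that] by auto
  have Vf: "concave_on {0..} (\<lambda>y. V (f \<theta> y z) j)" "mono_on {0..} (\<lambda>y. V (f \<theta> y z) j)"
    "continuous_on {0..} (\<lambda>y. V (f \<theta> y z) j)" if z: "0 \<le> z" for z j
  proof -
    show "concave_on {0..} (\<lambda>y. V (f \<theta> y z) j)"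
      using z by (intro concave_on_comp_mono[OF V_concave V_mono f_concave] f_nonneg) auto
    show "mono_on {0..} (\<lambda>y. V (f \<theta> y z) j)"
      using z f_nonneg by (auto intro!: mono_onI mono_onD[OF V_mono] mono_onD[OF f_mono])
    show "continuous_on {0..} (\<lambda>y. V (f \<theta> y z) j)"
      using z f_nonneg by (intro continuous_on_compose2[OF V_cont f_cont]) auto
  qed
  have Fq: "concave_on {0..} (\<lambda>y. F y q)" "mono_on {0..} (\<lambda>y. F y q)"
    "ennreal \<gamma> * (marginal (next_state \<theta> y q) * right_deriv (\<lambda>y. f \<theta> y (fst q)) y)
      \<le> right_deriv (\<lambda>y. F y q) y" if "q \<in> space (shock \<theta>)" for q
  proof -
    obtain z j where q: "q = (z, j)" "0 \<le> z" using \<open>q \<in> space (shock \<theta>)\<close> by (auto simp: space_shock)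
    have F: "F y q = ?U (V (f \<theta> y z) j)" for y
      by (simp add: F_def disc_def next_state_def q)
    show "concave_on {0..} (\<lambda>y. F y q)"
      unfolding F using q f_nonneg V_nonneg
      by (intro concave_on_comp_mono[OF utility_loss(1,2)[OF \<gamma>] Vf(1)]) auto
    show "mono_on {0..} (\<lambda>y. F y q)"
      unfolding F
    proof (rule mono_onI)
      fix a b :: real assume "a \<in> {0..}" "b \<in> {0..}" "a \<le> b"
      then have "V (f \<theta> a z) j \<le> V (f \<theta> b z) j"
        using mono_onD[OF Vf(2)[OF q(2)]] by blast
      then show "?U (V (f \<theta> a z) j) \<le> ?U (V (f \<theta> b z) j)"
        using \<gamma> by simp
    qed
    \<comment> \<open>The chain rule is used twice, for exponential loss after value and for value
      after production.\<close>
    have "ennreal \<gamma> * (marginal (next_state \<theta> y q) * right_deriv (\<lambda>y. f \<theta> y (fst q)) y)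
      = ennreal (\<gamma> * exp (- \<gamma> * V (f \<theta> y z) j)) * (right_deriv (\<lambda>x. V x j) (f \<theta> y z) * right_deriv (\<lambda>y. f \<theta> y z) y)"
      using \<gamma> by (simp add: marginal_def disc_def next_state_def q D_def ennreal_mult' ac_simps)
    also have "\<dots> \<le> right_deriv ?U (V (f \<theta> y z) j) * right_deriv (\<lambda>y. V (f \<theta> y z) j) y"
      using q y f_nonneg V_nonneg
      by (intro mult_mono utility_loss(3)[OF \<gamma>] right_deriv_comp[OF V_concave V_mono f_concave f_mono f_cont]) auto
    also have "\<dots> \<le> right_deriv (\<lambda>y. F y q) y"
      unfolding F using q y f_nonneg V_nonneg
      by (intro right_deriv_comp[OF utility_loss(1,2)[OF \<gamma>] Vf]) auto
    finally show "ennreal \<gamma> * (marginal (next_state \<theta> y q) * right_deriv (\<lambda>y. f \<theta> y (fst q)) y)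
      \<le> right_deriv (\<lambda>y. F y q) y" .
  qed
  have IF: "(\<integral>q. F y q \<partial>shock \<theta>) = 1 - H \<theta> y" if "0 \<le> y" for y
    unfolding F_def H_def using integrable_disc[OF that] by (simp add: prob_space)
  have meas: "(\<lambda>q. marginal (next_state \<theta> y q)
    * right_deriv (\<lambda>y. f \<theta> y (fst q)) y) \<in> borel_measurable (shock \<theta>)"
    by (intro borel_measurable_times_ennreal marginal_next_meas right_deriv_f_shock_meas y)
  have "ennreal \<gamma> * ?I \<le> right_deriv (\<lambda>y. \<integral>q. F y q \<partial>shock \<theta>) y"
    unfolding nn_integral_cmult[OF meas, symmetric]
    by (rule order_trans[OF nn_integral_mono[OF Fq(3)] nn_integral_right_deriv_le[OF Fq(1,2) int y]])
  also have "\<dots> \<le> ennreal (\<gamma> / \<beta> * deriv u (c x \<theta>))"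
  proof (rule LIMSEQ_le)
    show "(\<lambda>n. ennreal (real (Suc n) * ((\<integral>q. F (y + 1 / real (Suc n)) q \<partial>shock \<theta>) - (\<integral>q. F y q \<partial>shock \<theta>))))
      \<longlonglongrightarrow> right_deriv (\<lambda>y. \<integral>q. F y q \<partial>shock \<theta>) y"
      by (intro right_deriv_eqI_LIMSEQ concave_on_integral Fq int y)
    show "(\<lambda>n. ennreal (\<gamma> / \<beta> * (real (Suc n) * (u (c x \<theta>) - u (c x \<theta> - 1 / real (Suc n))))))
      \<longlonglongrightarrow> ennreal (\<gamma> / \<beta> * deriv u (c x \<theta>))"
      by (intro tendsto_ennrealI tendsto_mult tendsto_const LIMSEQ_left_quotients u_deriv c_pos x)
    \<comment> \<open>From here on the enlarged investment is still feasible: the extra amount is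
      less than current consumption.\<close>
    obtain N where N: "1 / real (Suc N) < c x \<theta>"
      using c_pos[OF x] nat_approx_posE by blast
    have "ennreal (real (Suc n) * ((\<integral>q. F (y + 1 / real (Suc n)) q \<partial>shock \<theta>) - (\<integral>q. F y q \<partial>shock \<theta>)))
      \<le> ennreal (\<gamma> / \<beta> * (real (Suc n) * (u (c x \<theta>) - u (c x \<theta> - 1 / real (Suc n)))))" if n: "N \<le> n" for n
    proof -
      define h where "h = 1 / real (Suc n)"
      have "h \<le> 1 / real (Suc N)" using n unfolding h_def by (intro frac_le) auto
      with N have h: "0 < h" "h < c x \<theta>" by (auto simp: h_def)
      have Hp: "0 < H \<theta> y" "H \<theta> y \<le> 1" "0 < H \<theta> (y + h)" using y h by (auto intro!: H_pos H_le_1)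
      have "u (c x \<theta> - h) - \<beta> / \<gamma> * ln (H \<theta> (y + h)) \<le> u (c x \<theta>) - \<beta> / \<gamma> * ln (H \<theta> y)"
        using V_ge_objective[of "y + h" x \<theta>] V_eq_objective[of x \<theta>] h y x by (simp add: y_def algebra_simps)
      then have "\<beta> / \<gamma> * (ln (H \<theta> y) - ln (H \<theta> (y + h))) \<le> u (c x \<theta>) - u (c x \<theta> - h)"
        by (simp add: algebra_simps)
      then have "\<gamma> / \<beta> * (\<beta> / \<gamma> * (ln (H \<theta> y) - ln (H \<theta> (y + h)))) \<le> \<gamma> / \<beta> * (u (c x \<theta>) - u (c x \<theta> - h))"
        using \<beta> \<gamma> by (intro mult_left_mono) auto
      then have 1: "ln (H \<theta> y) - ln (H \<theta> (y + h)) \<le> \<gamma> / \<beta> * (u (c x \<theta>) - u (c x \<theta> - h))"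
        using \<beta> \<gamma> by simp
      have "ln (H \<theta> (y + h) / H \<theta> y) \<le> H \<theta> (y + h) / H \<theta> y - 1"
        using Hp by (intro ln_le_minus_one) auto
      then have "H \<theta> y - H \<theta> (y + h) \<le> H \<theta> y * (ln (H \<theta> y) - ln (H \<theta> (y + h)))"
        using Hp by (simp add: ln_div field_simps)
      also have "\<dots> \<le> H \<theta> y * (\<gamma> / \<beta> * (u (c x \<theta>) - u (c x \<theta> - h)))"
        using Hp by (intro mult_left_mono 1) auto
      also have "\<dots> \<le> 1 * (\<gamma> / \<beta> * (u (c x \<theta>) - u (c x \<theta> - h)))"
        using Hp h \<beta> \<gamma> u_mono[of "c x \<theta> - h" "c x \<theta>"] by (intro mult_right_mono mult_nonneg_nonneg) auto
      finally have "real (Suc n) * (H \<theta> y - H \<theta> (y + h)) \<le> real (Suc n) * (\<gamma> / \<beta> * (u (c x \<theta>) - u (c x \<theta> - h)))"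
        by (intro mult_left_mono) auto
      then show ?thesis
        unfolding h_def[symmetric] using y h by (intro ennreal_leI) (simp add: IF ac_simps)
    qed
    then show "\<exists>N. \<forall>n\<ge>N. ennreal (real (Suc n) * ((\<integral>q. F (y + 1 / real (Suc n)) q \<partial>shock \<theta>) - (\<integral>q. F y q \<partial>shock \<theta>)))
      \<le> ennreal (\<gamma> / \<beta> * (real (Suc n) * (u (c x \<theta>) - u (c x \<theta> - 1 / real (Suc n)))))"
      by blast
  qed
  finally have "ennreal (\<beta> / \<gamma>) * (ennreal \<gamma> * ?I) \<le> ennreal (\<beta> / \<gamma>) * ennreal (\<gamma> / \<beta> * deriv u (c x \<theta>))"
    by (rule mult_left_mono) simp
  also have "ennreal (\<beta> / \<gamma>) * (ennreal \<gamma> * ?I) = ennreal \<beta> * ?I"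
    using \<beta> \<gamma> by (simp add: mult.assoc[symmetric] ennreal_mult'[symmetric])
  also have "ennreal (\<beta> / \<gamma>) * ennreal (\<gamma> / \<beta> * deriv u (c x \<theta>)) = D x \<theta>"
    using \<beta> \<gamma> by (simp add: ennreal_mult'[symmetric] D_eq[OF x])
  finally show ?thesis .
qed

text \<open>The limit in \<open>D1\<close> is strictly below 1, so a real \<open>r\<close> fits in
  between. The bound is restated for \<open>right_deriv\<close>, the form in which the marginal
  product enters \<open>euler\<close>, where zero investment is not yet excluded.\<close>

lemma marginal_product_bound:
  obtains r \<delta> where "0 < r" "r < 1" "0 < \<delta>"
    "\<And>y \<theta>. 0 < y \<Longrightarrow> y < \<delta> \<Longrightarrow>
      (\<integral>\<^sup>+z. 1 / (ennreal \<beta> * right_deriv (\<lambda>y. f \<theta> y z) y) \<partial>\<nu>) \<le> ennreal r"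
proof -
  obtain L where L: "L < 1" "((\<lambda>y. MAX \<theta>. \<integral>\<^sup>+ z. 1 / ennreal (\<beta> * deriv (\<lambda>y. f \<theta> y z) y) \<partial>\<nu>) \<longlongrightarrow> L) (at_right 0)"
    using D1 by blast
  obtain e where e: "L < e" "e < 1" using dense[OF L(1)] by blast
  then obtain r where r: "e = ennreal r" "0 \<le> r" by (cases e) auto
  have r': "0 < r" "r < 1"
    using e r by (auto simp: less_le)
  have "\<forall>\<^sub>F y in at_right 0. (MAX \<theta>. \<integral>\<^sup>+ z. 1 / ennreal (\<beta> * deriv (\<lambda>y. f \<theta> y z) y) \<partial>\<nu>) < e"
    using order_tendstoD(2)[OF L(2) e(1)] .
  then obtain \<delta> where \<delta>: "0 < \<delta>" "\<And>y. 0 < y \<Longrightarrow> y < \<delta> \<Longrightarrow>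
      (MAX \<theta>. \<integral>\<^sup>+ z. 1 / ennreal (\<beta> * deriv (\<lambda>y. f \<theta> y z) y) \<partial>\<nu>) < e"
    by (auto simp: eventually_at_right_field)
  show thesis
  proof (rule that[OF r' \<delta>(1)])
    fix y \<theta> assume y: "0 < y" "y < \<delta>"
    have "(\<integral>\<^sup>+z. 1 / (ennreal \<beta> * right_deriv (\<lambda>y. f \<theta> y z) y) \<partial>\<nu>)
      = (\<integral>\<^sup>+ z. 1 / ennreal (\<beta> * deriv (\<lambda>y. f \<theta> y z) y) \<partial>\<nu>)"
    proof (rule nn_integral_cong)
      fix z assume "z \<in> space \<nu>"
      then have "right_deriv (\<lambda>y. f \<theta> y z) y = ennreal (deriv (\<lambda>y. f \<theta> y z) y)"
        using y by (intro right_deriv_eq_deriv f_concave f_deriv) (auto simp: space_\<nu>)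
      then show "1 / (ennreal \<beta> * right_deriv (\<lambda>y. f \<theta> y z) y) = 1 / ennreal (\<beta> * deriv (\<lambda>y. f \<theta> y z) y)"
        using \<beta> by (simp add: ennreal_mult')
    qed
    also have "\<dots> \<le> (MAX \<theta>. \<integral>\<^sup>+ z. 1 / ennreal (\<beta> * deriv (\<lambda>y. f \<theta> y z) y) \<partial>\<nu>)"
      by (intro Max_ge) auto
    also have "\<dots> \<le> ennreal r"
      unfolding r(1)[symmetric] by (rule less_imp_le[OF \<delta>(2)[OF y]])
    finally show "(\<integral>\<^sup>+z. 1 / (ennreal \<beta> * right_deriv (\<lambda>y. f \<theta> y z) y) \<partial>\<nu>) \<le> ennreal r" .
  qed
qed

text \<open>Without investment the next income is 0, where \<open>marginal\<close> is infinite. As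
  \<open>D x \<theta>\<close> is finite, \<open>euler\<close> then forces the production slope at 0
  to vanish almost surely, hence by concavity every later slope too, and the reciprocals in
  \<open>D1\<close> could not be integrable.\<close>

lemma \<phi>_pos:
  assumes x: "0 < x"
  shows "0 < \<phi> x \<theta>"
proof (rule ccontr)
  assume "\<not> 0 < \<phi> x \<theta>"
  then have 0: "\<phi> x \<theta> = 0" using \<phi>_nonneg[of x \<theta>] x by simp
  note rm = right_deriv_f_meas[OF order_refl, of \<theta>]
  have "(\<integral>\<^sup>+q. marginal (next_state \<theta> 0 q)
    * right_deriv (\<lambda>y. f \<theta> y (fst q)) 0 \<partial>shock \<theta>) = (\<integral>\<^sup>+q. \<top> * right_deriv (\<lambda>y. f \<theta> y (fst q)) 0 \<partial>shock \<theta>)"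
    by (intro nn_integral_cong) (auto simp: marginal_def next_state_def disc_def space_shock F4 V_0 D_0)
  also have "\<dots> = (\<integral>\<^sup>+z. \<top> * right_deriv (\<lambda>y. f \<theta> y z) 0 \<partial>\<nu>)"
    using rm by (intro nn_integral_shock_fst) auto
  also have "\<dots> = \<top> * (\<integral>\<^sup>+z. right_deriv (\<lambda>y. f \<theta> y z) 0 \<partial>\<nu>)"
    using rm by (rule nn_integral_cmult)
  finally have "ennreal \<beta> * (\<top> * (\<integral>\<^sup>+z. right_deriv (\<lambda>y. f \<theta> y z) 0 \<partial>\<nu>)) \<le> D x \<theta>"
    using euler[OF x, of \<theta>] by (simp only: 0)
  also have "\<dots> < \<top>"
    using D_finite[OF x, of \<theta>] by simp
  finally have "(\<integral>\<^sup>+z. right_deriv (\<lambda>y. f \<theta> y z) 0 \<partial>\<nu>) = 0"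
    using \<beta> by (auto simp: ennreal_top_mult ennreal_mult_top split: if_splits)
  then have ae0: "AE z in \<nu>. right_deriv (\<lambda>y. f \<theta> y z) 0 = 0"
    using rm by (simp add: nn_integral_0_iff_AE)
  obtain r \<delta> where r: "0 < \<delta>" "\<And>y \<theta>. 0 < y \<Longrightarrow> y < \<delta> \<Longrightarrow>
      (\<integral>\<^sup>+z. 1 / (ennreal \<beta> * right_deriv (\<lambda>y. f \<theta> y z) y) \<partial>\<nu>) \<le> ennreal r"
    by (rule marginal_product_bound) blast
  define h where "h = \<delta> / 2"
  have h: "0 < h" "h < \<delta>" using r by (auto simp: h_def)
  have "(\<integral>\<^sup>+z. 1 / (ennreal \<beta> * right_deriv (\<lambda>y. f \<theta> y z) h) \<partial>\<nu>) < \<top>"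
    using r(2)[OF h, of \<theta>] by (rule le_less_trans) simp
  then have "AE z in \<nu>. 1 / (ennreal \<beta> * right_deriv (\<lambda>y. f \<theta> y z) h) \<noteq> \<infinity>"
    using right_deriv_f_meas[of h \<theta>] h by (intro nn_integral_PInf_AE) auto
  with ae0 AE_space have "AE z in \<nu>. False"
  proof eventually_elim
    case (elim z)
    have "right_deriv (\<lambda>y. f \<theta> y z) h \<le> right_deriv (\<lambda>y. f \<theta> y z) 0"
      using elim h by (intro right_deriv_antimono f_concave) (auto simp: space_\<nu>)
    with elim show False by simp
  qed
  then show False by simp
qed

end

section \<open>Drift and existence\<close>

lemma seq_continuous_on_integral:
  fixes F :: "real \<Rightarrow> 'a \<Rightarrow> real"
  assumes M: "finite_measure M"
    and F: "\<And>z. z \<in> space M \<Longrightarrow> continuous_on S (\<lambda>x. F x z)"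
    and meas: "\<And>x. x \<in> S \<Longrightarrow> F x \<in> borel_measurable M"
    and bound: "\<And>x z. \<bar>F x z\<bar> \<le> B"
  shows "continuous_on S (\<lambda>x. \<integral>z. F x z \<partial>M)"
proof (rule continuous_on_sequentiallyI)
  interpret finite_measure M by fact
  fix X a assume X: "\<forall>n. X n \<in> S" "a \<in> S" "X \<longlonglongrightarrow> a"
  show "(\<lambda>n. \<integral>z. F (X n) z \<partial>M) \<longlonglongrightarrow> (\<integral>z. F a z \<partial>M)"
  proof (rule integral_dominated_convergence[where w="\<lambda>_. B"])
    show "AE z in M. (\<lambda>n. F (X n) z) \<longlonglongrightarrow> F a z"
      using X by (intro AE_I2 continuous_on_tendsto_compose[OF F]) auto
  qed (use X meas bound in auto)
qed

context growth_model
begin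

definition W :: "real \<times> 's \<Rightarrow> ennreal" where
  "W s = esqrt (marginal s)"

lemma W_meas: "W \<in> borel_measurable state_space"
  using measurable_compose[OF marginal_meas borel_measurable_esqrt] by (simp add: W_def[abs_def])

lemma W_0: "W (0, \<theta>) = \<top>"
  by (simp add: W_def marginal_def disc_def V_0 D_0)

lemma W_antimono: "0 \<le> x \<Longrightarrow> x \<le> y \<Longrightarrow> W (y, \<theta>) \<le> W (x, \<theta>)"
  using mono_onD[OF V_mono, of x y \<theta>] \<gamma>
  by (auto simp: W_def marginal_def disc_def intro!: esqrt_mono mult_mono D_antimono ennreal_leI mult_left_mono)

lemma deriv_u_pos: "0 < a \<Longrightarrow> 0 < deriv u a"
  using le_less_trans[OF zero_le right_deriv_u_strict[of a "a + 1"]] by (simp add: right_deriv_u)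

lemma W_eq:
  assumes "0 < x"
  shows "W (x, \<theta>) = ennreal (sqrt (exp (- \<gamma> * V x \<theta>) * deriv u (c x \<theta>)))"
  using deriv_u_pos[OF c_pos[OF assms, of \<theta>]]
  by (simp add: W_def marginal_def disc_def D_eq[OF assms] ennreal_mult'[symmetric] esqrt_ennreal)

text \<open>Cauchy--Schwarz splits \<open>W\<close> at the next state into the integrand of the Euler inequality and the
  reciprocal marginal product of (D1).\<close>

lemma W_step:
  assumes x: "0 < x" and r: "0 < r" "(\<integral>\<^sup>+z. 1 / (ennreal \<beta> * right_deriv (\<lambda>y. f \<theta> y z) (\<phi> x \<theta>)) \<partial>\<nu>) \<le> ennreal r"
  shows "(\<integral>\<^sup>+q. W (next_state \<theta> (\<phi> x \<theta>) q) \<partial>shock \<theta>) \<le> ennreal (sqrt (r * deriv u (c x \<theta>)))"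
  unfolding W_def
proof (rule nn_integral_esqrt_le)
  let ?y = "\<phi> x \<theta>"
  have y: "0 \<le> ?y" using x by (simp add: \<phi>_nonneg)
  show "(\<lambda>q. marginal (next_state \<theta> ?y q)) \<in> borel_measurable (shock \<theta>)"
    by (rule marginal_next_meas[OF y])
  show bm: "(\<lambda>q. ennreal \<beta> * right_deriv (\<lambda>y. f \<theta> y (fst q)) ?y) \<in> borel_measurable (shock \<theta>)"
    by (intro borel_measurable_times_ennreal right_deriv_f_shock_meas[OF y]) simp
  have "(\<integral>\<^sup>+q. marginal (next_state \<theta> ?y q) * (ennreal \<beta> * right_deriv (\<lambda>y. f \<theta> y (fst q)) ?y) \<partial>shock \<theta>)
    = (\<integral>\<^sup>+q. ennreal \<beta> * (marginal (next_state \<theta> ?y q) * right_deriv (\<lambda>y. f \<theta> y (fst q)) ?y) \<partial>shock \<theta>)"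
    by (simp add: ac_simps)
  also have "\<dots> = ennreal \<beta> * (\<integral>\<^sup>+q. marginal (next_state \<theta> ?y q) * right_deriv (\<lambda>y. f \<theta> y (fst q)) ?y \<partial>shock \<theta>)"
    by (intro nn_integral_cmult borel_measurable_times_ennreal marginal_next_meas right_deriv_f_shock_meas y)
  also have "\<dots> \<le> ennreal (deriv u (c x \<theta>))"
    using euler[OF x, of \<theta>] by (simp only: D_eq[OF x])
  finally show "(\<integral>\<^sup>+q. marginal (next_state \<theta> ?y q) * (ennreal \<beta> * right_deriv (\<lambda>y. f \<theta> y (fst q)) ?y) \<partial>shock \<theta>)
    \<le> ennreal (deriv u (c x \<theta>))" .
  show "0 < deriv u (c x \<theta>)" by (intro deriv_u_pos c_pos x)
  have "(\<lambda>z. 1 / (ennreal \<beta> * right_deriv (\<lambda>y. f \<theta> y z) ?y)) \<in> borel_measurable \<nu>"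
    using right_deriv_f_meas[OF y, of \<theta>] by measurable
  then show "(\<integral>\<^sup>+q. 1 / (ennreal \<beta> * right_deriv (\<lambda>y. f \<theta> y (fst q)) ?y) \<partial>shock \<theta>) \<le> ennreal r"
    using r(2) by (subst nn_integral_shock_fst[of "\<lambda>z. 1 / (ennreal \<beta> * right_deriv (\<lambda>y. f \<theta> y z) ?y)"])
qed (rule r)

text \<open>For small positive incomes \<open>W_step\<close> yields sqrt (r exp (\<gamma> V)) times
  \<open>W\<close>, a contraction as \<open>V\<close> tends to 0. Above \<open>x0\<close>
  monotonicity reduces to the bound at \<open>x0\<close>, and at income 0 the right side is
  infinite.\<close>

lemma W_drift:
  obtains l K where "0 < l" "l < 1" "0 \<le> K"
    "\<And>x \<theta>. 0 \<le> x \<Longrightarrow> (\<integral>\<^sup>+q. W (next_state \<theta> (\<phi> x \<theta>) q) \<partial>shock \<theta>) \<le> ennreal l * W (x, \<theta>) + ennreal K"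
proof -
  obtain r \<delta> where r: "0 < r" "r < 1" "0 < \<delta>"
    and D1r: "\<And>y \<theta>. 0 < y \<Longrightarrow> y < \<delta> \<Longrightarrow>
      (\<integral>\<^sup>+z. 1 / (ennreal \<beta> * right_deriv (\<lambda>y. f \<theta> y z) y) \<partial>\<nu>) \<le> ennreal r"
    by (rule marginal_product_bound) blast
  \<comment> \<open>Midway between \<open>r\<close> and 1: the room left for exp (\<gamma> V) near
    zero income.\<close>
  define e where "e = (1 + r) / 2"
  have e: "r < e" "e < 1" "0 < e" using r by (auto simp: e_def)
  have "\<forall>\<^sub>F x in at_right 0. r * exp (\<gamma> * V x \<theta>) < e" for \<theta>
  proof -
    have "((\<lambda>x. V x \<theta>) \<longlongrightarrow> V 0 \<theta>) (at 0 within {0..})"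
      using V_cont by (auto simp: continuous_on_def)
    then have "((\<lambda>x. V x \<theta>) \<longlongrightarrow> 0) (at_right 0)"
      unfolding V_0 by (rule tendsto_within_subset) auto
    then have "((\<lambda>x. r * exp (\<gamma> * V x \<theta>)) \<longlongrightarrow> r * exp (\<gamma> * 0)) (at_right 0)"
      by (intro tendsto_intros)
    then show ?thesis using e by (intro order_tendstoD(2)) auto
  qed
  then have "\<forall>\<^sub>F x in at_right 0. \<forall>\<theta>. r * exp (\<gamma> * V x \<theta>) < e"
    by (rule eventually_all_finite)
  moreover have "\<forall>\<^sub>F x in at_right 0. x \<in> {0<..<\<delta>}"
    by (rule eventually_at_right_real[OF r(3)])
  ultimately have "\<forall>\<^sub>F x in at_right 0. x \<in> {0<..<\<delta>} \<and> (\<forall>\<theta>. r * exp (\<gamma> * V x \<theta>) < e)"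
    by eventually_elim auto
  then obtain x0 where x0: "0 < x0" "x0 < \<delta>" "\<And>\<theta>. r * exp (\<gamma> * V x0 \<theta>) < e"
    using eventually_happens[of _ "at_right (0::real)"] by auto
  define l where "l = sqrt e"
  have l: "0 < l" "l < 1" using e by (auto simp: l_def)
  \<comment> \<open>A sum over the finitely many regimes bounds all the finite values
    \<open>W (x0, \<theta>)\<close> at once.\<close>
  define K where "K = (\<Sum>\<theta>\<in>UNIV. enn2real (W (x0, \<theta>)))"
  have K: "0 \<le> K" by (auto simp: K_def intro: sum_nonneg)
  have WK: "W (x0, \<theta>) \<le> ennreal K" for \<theta>
  proof -
    have "enn2real (W (x0, \<theta>)) \<le> K" unfolding K_def by (intro member_le_sum) auto
    then show ?thesis
      using W_eq[OF x0(1), of \<theta>] by (metis ennreal_leI ennreal_enn2real ennreal_less_top)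
  qed
  have small: "(\<integral>\<^sup>+q. W (next_state \<theta> (\<phi> x \<theta>) q) \<partial>shock \<theta>) \<le> ennreal l * W (x, \<theta>)" if x: "0 < x" "x \<le> x0" for x \<theta>
  proof -
    have "V x \<theta> \<le> V x0 \<theta>" using mono_onD[OF V_mono] x by auto
    then have "r * exp (\<gamma> * V x \<theta>) \<le> r * exp (\<gamma> * V x0 \<theta>)"
      using r \<gamma> by auto
    then have "r * exp (\<gamma> * V x \<theta>) \<le> e" using x0(3)[of \<theta>] by linarith
    then have "r * exp (\<gamma> * V x \<theta>) * exp (- \<gamma> * V x \<theta>) \<le> e * exp (- \<gamma> * V x \<theta>)"
      by (rule mult_right_mono) simp
    then have re: "r \<le> e * exp (- \<gamma> * V x \<theta>)"
      by (simp add: mult.assoc exp_add[symmetric])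
    have "(\<integral>\<^sup>+q. W (next_state \<theta> (\<phi> x \<theta>) q) \<partial>shock \<theta>) \<le> ennreal (sqrt (r * deriv u (c x \<theta>)))"
      using x x0 r \<phi>_pos[OF x(1), of \<theta>] \<phi>_le[of x \<theta>] by (intro W_step D1r) auto
    also have "\<dots> \<le> ennreal (sqrt (e * exp (- \<gamma> * V x \<theta>) * deriv u (c x \<theta>)))"
      using deriv_u_pos[OF c_pos[OF x(1), of \<theta>]] by (intro ennreal_leI real_sqrt_le_mono mult_right_mono re) auto
    also have "\<dots> = ennreal l * W (x, \<theta>)"
      using e by (simp add: W_eq[OF x(1)] l_def ennreal_mult'[symmetric] real_sqrt_mult mult.assoc)
    finally show ?thesis .
  qed
  show thesis
  proof (rule that[OF l K])
    fix x :: real and \<theta> assume "0 \<le> x"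
    then consider "x = 0" | "0 < x" "x \<le> x0" | "x0 < x" by linarith
    then show "(\<integral>\<^sup>+q. W (next_state \<theta> (\<phi> x \<theta>) q) \<partial>shock \<theta>) \<le> ennreal l * W (x, \<theta>) + ennreal K"
    proof cases
      case 1
      then show ?thesis using l by (simp add: W_0 ennreal_mult_top)
    next
      case 2
      then show ?thesis using small[of x \<theta>] by (auto intro: order_trans add_increasing2)
    next
      \<comment> \<open>Compare with the start \<open>x0\<close> under the same draw
        \<open>q\<close>: a larger income leads to a larger next income, where \<open>W\<close> is
        smaller.\<close>
      case 3
      have "(\<integral>\<^sup>+q. W (next_state \<theta> (\<phi> x \<theta>) q) \<partial>shock \<theta>) \<le> (\<integral>\<^sup>+q. W (next_state \<theta> (\<phi> x0 \<theta>) q) \<partial>shock \<theta>)"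
      proof (rule nn_integral_mono)
        fix q assume "q \<in> space (shock \<theta>)"
        then obtain z j where q: "q = (z, j)" "0 \<le> z" by (auto simp: space_shock)
        have "f \<theta> (\<phi> x0 \<theta>) z \<le> f \<theta> (\<phi> x \<theta>) z"
          using 3 x0 q \<phi>_mono[of x0 x \<theta>] \<phi>_nonneg by (intro mono_onD[OF f_mono]) auto
        then show "W (next_state \<theta> (\<phi> x \<theta>) q) \<le> W (next_state \<theta> (\<phi> x0 \<theta>) q)"
          unfolding next_state_def q fst_conv snd_conv using x0 q \<phi>_nonneg by (intro W_antimono f_nonneg) auto
      qed
      also have "\<dots> \<le> ennreal l * W (x0, \<theta>)" using x0 by (intro small) auto
      also have "\<dots> \<le> 1 * ennreal K" using l by (intro mult_mono WK) auto
      finally show ?thesis by (auto intro: order_trans add_increasing)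
    qed
  qed
qed

definition L :: "real \<times> 's \<Rightarrow> ennreal" where
  "L s = W s + ennreal (fst s)"

lemma L_meas: "L \<in> borel_measurable state_space"
  using W_meas measurable_fst_state_space unfolding L_def[abs_def] by measurable

lemma nn_integral_income_kernel:
  assumes "0 \<le> x" "h \<in> borel_measurable state_space"
  shows "integral\<^sup>N (income_kernel p \<nu> f \<phi> (x, \<theta>)) h = (\<integral>\<^sup>+q. h (next_state \<theta> (\<phi> x \<theta>) q) \<partial>shock \<theta>)"
  unfolding income_kernel_eq
  by (intro nn_integral_distr next_state_measurable \<phi>_nonneg) (use assms in simp_all)

lemma L_drift:
  obtains l K where "0 \<le> l" "l < 1" "0 \<le> K"
    "\<And>s. s \<in> space state_space \<Longrightarrow> integral\<^sup>N (income_kernel p \<nu> f \<phi> s) L \<le> ennreal l * L s + ennreal K"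
proof -
  obtain l K where l: "0 < l" "l < 1" "0 \<le> K"
    and W: "\<And>x \<theta>. 0 \<le> x \<Longrightarrow> (\<integral>\<^sup>+q. W (next_state \<theta> (\<phi> x \<theta>) q) \<partial>shock \<theta>) \<le> ennreal l * W (x, \<theta>) + ennreal K"
    by (rule W_drift) blast
  obtain l2 k where l2: "0 < l2" "l2 < 1" "0 < k"
    and D2': "\<And>y. 0 \<le> y \<Longrightarrow> (MAX \<theta>. \<integral>\<^sup>+ z. ennreal (f \<theta> y z) \<partial>\<nu>) \<le> ennreal (l2 * y + k)"
    using D2 by blast
  \<comment> \<open>One factor for both summands; the bound on mean production in terms of
    investment carries over to income because \<open>\<phi> x \<theta> \<le> x\<close>.\<close>
  define m where "m = max l l2"
  have m: "0 \<le> m" "m < 1" "l \<le> m" "l2 \<le> m" using l l2 by (auto simp: m_def)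
  show thesis
  proof (rule that[OF m(1,2)])
    show "0 \<le> K + k" using l l2 by simp
    fix s :: "real \<times> 's" assume "s \<in> space state_space"
    then obtain x \<theta> where s: "s = (x, \<theta>)" "0 \<le> x" by (auto simp: space_state_space)
    let ?y = "\<phi> x \<theta>"
    have y: "0 \<le> ?y" "?y \<le> x" using s \<phi>_nonneg \<phi>_le by auto
    have "(\<integral>\<^sup>+q. ennreal (f \<theta> ?y (fst q)) \<partial>shock \<theta>) = (\<integral>\<^sup>+z. ennreal (f \<theta> ?y z) \<partial>\<nu>)"
      using f_meas_\<nu>[OF y(1)] by (intro nn_integral_shock_fst[of "\<lambda>z. ennreal (f \<theta> ?y z)"]) measurable
    also have "\<dots> \<le> (MAX \<theta>. \<integral>\<^sup>+ z. ennreal (f \<theta> ?y z) \<partial>\<nu>)"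
      by (intro Max_ge) auto
    also have "\<dots> \<le> ennreal (l2 * ?y + k)" by (rule D2'[OF y(1)])
    also have "\<dots> \<le> ennreal (m * x + k)"
      using y m l2 by (intro ennreal_leI add_right_mono mult_mono) auto
    also have "\<dots> = ennreal m * ennreal x + ennreal k"
      using s m l2 by (simp add: ennreal_mult ennreal_plus)
    finally have fx: "(\<integral>\<^sup>+q. ennreal (f \<theta> ?y (fst q)) \<partial>shock \<theta>) \<le> ennreal m * ennreal x + ennreal k" .
    have "(\<integral>\<^sup>+q. W (next_state \<theta> ?y q) \<partial>shock \<theta>) \<le> ennreal m * W (x, \<theta>) + ennreal K"
      by (rule order_trans[OF W[OF s(2)]]) (intro add_right_mono mult_right_mono ennreal_leI m, simp)
    with fx have "(\<integral>\<^sup>+q. W (next_state \<theta> ?y q) \<partial>shock \<theta>) + (\<integral>\<^sup>+q. ennreal (f \<theta> ?y (fst q)) \<partial>shock \<theta>)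
      \<le> (ennreal m * W (x, \<theta>) + ennreal K) + (ennreal m * ennreal x + ennreal k)"
      by (intro add_mono)
    also have "\<dots> = ennreal m * L s + ennreal (K + k)"
      using l l2 by (simp add: L_def s ennreal_plus distrib_left ac_simps)
    also have "(\<integral>\<^sup>+q. W (next_state \<theta> ?y q) \<partial>shock \<theta>) + (\<integral>\<^sup>+q. ennreal (f \<theta> ?y (fst q)) \<partial>shock \<theta>)
      = (\<integral>\<^sup>+q. L (next_state \<theta> ?y q) \<partial>shock \<theta>)"
      unfolding L_def
      using measurable_compose[OF next_state_measurable[OF y(1)] W_meas, of \<theta> \<theta>]
        measurable_compose[OF next_state_measurable[OF y(1)] measurable_fst_state_space, of \<theta> \<theta>]
      by (subst nn_integral_add) (auto simp: next_state_def)
    finally show "integral\<^sup>N (income_kernel p \<nu> f \<phi> s) L \<le> ennreal m * L s + ennreal (K + k)"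
      unfolding s(1) nn_integral_income_kernel[OF s(2) L_meas] .
  qed
qed

text \<open>Large incomes are handled by the summand \<open>fst s\<close>. Near 0 the slope of
  \<open>V\<close> is replaced by a quotient with one fixed step, which bounds it from below and,
  unlike the slope itself, is continuous in \<open>x\<close> up to 0, so that its large value there
  persists nearby.\<close>

lemma L_coercive: "\<exists>e>0. \<forall>x \<theta>. 0 \<le> x \<and> (x < e \<or> 1 / e < x) \<longrightarrow> ennreal R \<le> L (x, \<theta>)"
proof -
  have "\<forall>\<^sub>F x in at 0 within {0..}. ennreal R \<le> W (x, \<theta>)" for \<theta>
  proof -
    have "ennreal (R\<^sup>2) < right_deriv u 0" by (simp add: right_deriv_u_0)
    then obtain n where "ennreal (R\<^sup>2) < ennreal (real (Suc n) * (u (0 + 1 / real (Suc n)) - u 0))"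
      unfolding right_deriv_def less_SUP_iff by blast
    then have n: "R\<^sup>2 < real (Suc n) * u (1 / real (Suc n))"
      by (simp add: ennreal_less_iff U1(3) del: of_nat_Suc)
    define h where "h = 1 / real (Suc n)"
    have h: "0 < h" by (simp add: h_def)
    define g where "g x = exp (- \<gamma> * V x \<theta>) * ((V (x + h) \<theta> - V x \<theta>) / h)" for x
    have "R\<^sup>2 < u h / h" using n by (simp add: h_def mult.commute)
    also have "\<dots> \<le> g 0"
      using V_ge_u[of h \<theta>] h by (simp add: g_def V_0 divide_right_mono)
    finally have g0: "R\<^sup>2 < g 0" .
    have "continuous_on {0..} g"
      unfolding g_def using h
      by (intro continuous_intros V_cont continuous_on_compose2[OF V_cont]) auto
    then have "(g \<longlongrightarrow> g 0) (at 0 within {0..})" by (auto simp: continuous_on_def)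
    then have "\<forall>\<^sub>F x in at 0 within {0..}. R\<^sup>2 < g x" by (rule order_tendstoD(1)[OF _ g0])
    moreover have "\<forall>\<^sub>F x in at 0 within {0..}. x \<in> {0..}" by (simp add: eventually_at_filter)
    ultimately show ?thesis
    proof eventually_elim
      case (elim x)
      \<comment> \<open>\<open>R\<close> may be negative; the square root of its square is its
        absolute value.\<close>
      have "ennreal R \<le> ennreal (sqrt (R\<^sup>2))" by (intro ennreal_leI) auto
      also have "\<dots> = esqrt (ennreal (R\<^sup>2))" by (rule esqrt_ennreal[symmetric]) simp
      also have "\<dots> \<le> esqrt (ennreal (g x))" using elim by (intro esqrt_mono ennreal_leI) simp
      also have "\<dots> \<le> W (x, \<theta>)"
        unfolding W_def marginal_def g_def disc_def D_def fst_conv snd_conv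
        using elim h by (subst ennreal_mult') (auto intro!: esqrt_mono mult_left_mono right_deriv_ge_quotient[OF V_concave])
      finally show ?case .
    qed
  qed
  then have "\<forall>\<^sub>F x in at 0 within {0..}. \<forall>\<theta>. ennreal R \<le> W (x, \<theta>)"
    by (rule eventually_all_finite)
  then obtain d where d: "0 < d" "\<And>x \<theta>. 0 < x \<Longrightarrow> x < d \<Longrightarrow> ennreal R \<le> W (x, \<theta>)"
    unfolding eventually_at by (auto simp: dist_real_def)
  \<comment> \<open>The second bound makes \<open>x > 1 / e\<close> imply
    \<open>x > \<bar>R\<bar>\<close>.\<close>
  define e where "e = min d (1 / (\<bar>R\<bar> + 1))"
  have e: "0 < e" using d by (simp add: e_def)
  have "ennreal R \<le> L (x, \<theta>)" if x: "0 \<le> x" "x < e \<or> 1 / e < x" for x \<theta>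
  proof (cases "x < e")
    case True
    then have "ennreal R \<le> W (x, \<theta>)"
      using d(2)[of x \<theta>] x by (cases "x = 0") (auto simp: e_def W_0)
    then show ?thesis by (simp add: L_def add_increasing2)
  next
    case False
    have "e \<le> 1 / (\<bar>R\<bar> + 1)" by (simp add: e_def)
    then have "\<bar>R\<bar> + 1 \<le> 1 / e" using e by (simp add: field_simps)
    then have "ennreal R \<le> ennreal x" using False x by (intro ennreal_leI) auto
    then show ?thesis by (simp add: L_def add_increasing)
  qed
  with e show ?thesis by blast
qed

text \<open>The shock law is the same for all incomes, so continuity holds draw by draw and passes
  to the mean by bounded convergence. Positive incomes are those where
  \<open>\<phi>_continuous\<close> applies.\<close>

lemma income_kernel_feller:
  fixes g :: "real \<times> 's \<Rightarrow> real"
  assumes g: "g \<in> borel_measurable state_space" "\<And>s. \<bar>g s\<bar> \<le> 1" "\<And>j. continuous_on {0..} (\<lambda>x. g (x, j))"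
  shows "continuous_on {0<..} (\<lambda>x. integral\<^sup>L (income_kernel p \<nu> f \<phi> (x, \<theta>)) g)"
proof -
  have "continuous_on {0<..} (\<lambda>x. \<integral>q. g (next_state \<theta> (\<phi> x \<theta>) q) \<partial>shock \<theta>)"
  proof (rule seq_continuous_on_integral)
    show "finite_measure (shock \<theta>)" using prob_space_shock by (simp add: prob_space_def)
    fix q assume "q \<in> space (shock \<theta>)"
    then obtain z j where q: "q = (z, j)" "0 \<le> z" by (auto simp: space_shock)
    show "continuous_on {0<..} (\<lambda>x. g (next_state \<theta> (\<phi> x \<theta>) q))"
      unfolding q next_state_def fst_conv snd_conv
      using q(2) \<phi>_nonneg f_nonneg
      by (intro continuous_on_compose2[OF g(3) continuous_on_compose2[OF f_cont \<phi>_continuous]]) auto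
  next
    fix x :: real assume "x \<in> {0<..}"
    then show "(\<lambda>q. g (next_state \<theta> (\<phi> x \<theta>) q)) \<in> borel_measurable (shock \<theta>)"
      by (intro measurable_compose[OF next_state_measurable g(1)] \<phi>_nonneg) auto
  qed (rule g(2))
  moreover have eq: "integral\<^sup>L (income_kernel p \<nu> f \<phi> (x, \<theta>)) g = (\<integral>q. g (next_state \<theta> (\<phi> x \<theta>) q) \<partial>shock \<theta>)"
    if "x \<in> {0<..}" for x
    unfolding income_kernel_eq using that by (intro integral_distr next_state_measurable \<phi>_nonneg g(1)) auto
  ultimately show ?thesis
    by (auto elim: continuous_on_eq)
qed

section \<open>Measurability of the kernel and conclusion\<close>

text \<open>A function continuous in one variable and measurable in the other is jointly measurable:
  round \<open>y\<close> down to a multiple of \<open>1 / (n + 1)\<close>, which leaves countably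
  many measurable pieces, and let \<open>n\<close> grow.\<close>

lemma f_joint_meas: "(\<lambda>(y, z). f \<theta> y z) \<in> halfline \<Otimes>\<^sub>M \<nu> \<rightarrow>\<^sub>M halfline"
proof (rule measurable_restrict_space2)
  have sp: "space (halfline \<Otimes>\<^sub>M \<nu>) = {0..} \<times> {0..}"
    by (simp add: space_pair_measure space_restrict_space space_\<nu>)
  show "(\<lambda>(y, z). f \<theta> y z) \<in> space (halfline \<Otimes>\<^sub>M \<nu>) \<rightarrow> {0..}"
    by (auto simp: sp f_nonneg)
  have fst_m: "fst \<in> borel_measurable (halfline \<Otimes>\<^sub>M \<nu>)"
    by (rule measurable_compose[OF measurable_fst]) (auto intro: measurable_restrict_space1)
  show "(\<lambda>(y, z). f \<theta> y z) \<in> borel_measurable (halfline \<Otimes>\<^sub>M \<nu>)"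
  proof (rule borel_measurable_LIMSEQ_real)
    fix s assume "s \<in> space (halfline \<Otimes>\<^sub>M \<nu>)"
    then obtain y z where s: "s = (y, z)" "0 \<le> y" "0 \<le> z" by (auto simp: sp)
    have "(\<lambda>n. real (nat \<lfloor>real (Suc n) * y\<rfloor>) / real (Suc n)) \<longlonglongrightarrow> y"
    proof (rule real_tendsto_sandwich)
      have "y - 1 / real (Suc n) \<le> real (nat \<lfloor>real (Suc n) * y\<rfloor>) / real (Suc n)" for n
      proof -
        have "real (Suc n) * y - 1 \<le> real (nat \<lfloor>real (Suc n) * y\<rfloor>)" by linarith
        then have "(real (Suc n) * y - 1) / real (Suc n) \<le> real (nat \<lfloor>real (Suc n) * y\<rfloor>) / real (Suc n)"
          by (rule divide_right_mono) simp
        then show ?thesis by (simp add: diff_divide_distrib del: of_nat_Suc)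
      qed
      then show "\<forall>\<^sub>F n in sequentially. y - 1 / real (Suc n) \<le> real (nat \<lfloor>real (Suc n) * y\<rfloor>) / real (Suc n)"
        by simp
      have "real (nat \<lfloor>real (Suc n) * y\<rfloor>) / real (Suc n) \<le> y" for n
      proof -
        have "0 \<le> real (Suc n) * y" using s(2) by simp
        then have "real (nat \<lfloor>real (Suc n) * y\<rfloor>) \<le> real (Suc n) * y" by linarith
        then have "real (nat \<lfloor>real (Suc n) * y\<rfloor>) / real (Suc n) \<le> (real (Suc n) * y) / real (Suc n)"
          by (rule divide_right_mono) simp
        then show ?thesis by (simp del: of_nat_Suc)
      qed
      then show "\<forall>\<^sub>F n in sequentially. real (nat \<lfloor>real (Suc n) * y\<rfloor>) / real (Suc n) \<le> y"
        by simp
      have "(\<lambda>n. y - 1 / real (Suc n)) \<longlonglongrightarrow> y - 0"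
        by (intro tendsto_diff tendsto_const LIMSEQ_Suc[OF lim_1_over_n])
      then show "(\<lambda>n. y - 1 / real (Suc n)) \<longlonglongrightarrow> y" by simp
    qed simp
    then show "(\<lambda>n. f \<theta> (real (nat \<lfloor>real (Suc n) * fst s\<rfloor>) / real (Suc n)) (snd s)) \<longlonglongrightarrow> (case s of (y, z) \<Rightarrow> f \<theta> y z)"
      using s by (auto intro!: continuous_on_tendsto_compose[OF f_cont])
  next
    fix n
    show "(\<lambda>s. f \<theta> (real (nat \<lfloor>real (Suc n) * fst s\<rfloor>) / real (Suc n)) (snd s)) \<in> borel_measurable (halfline \<Otimes>\<^sub>M \<nu>)"
    proof (rule measurable_compose_countable[where f="\<lambda>k s. f \<theta> (real k / real (Suc n)) (snd s)" and g="\<lambda>s. nat \<lfloor>real (Suc n) * fst s\<rfloor>"])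
      show "(\<lambda>s. f \<theta> (real k / real (Suc n)) (snd s)) \<in> borel_measurable (halfline \<Otimes>\<^sub>M \<nu>)" for k
        by (rule measurable_compose[OF measurable_snd f_meas_\<nu>]) simp
      show "(\<lambda>s. nat \<lfloor>real (Suc n) * fst s\<rfloor>) \<in> halfline \<Otimes>\<^sub>M \<nu> \<rightarrow>\<^sub>M count_space UNIV"
        using fst_m by measurable
    qed
  qed
qed

text \<open>The kernel is the image of a law depending on the regime alone under a map jointly
  measurable in state and draw; dependence on the discrete regime is handled one regime at a
  time.\<close>

lemma income_kernel_meas: "income_kernel p \<nu> f \<phi> \<in> state_space \<rightarrow>\<^sub>M prob_algebra state_space"
proof -
  have 1: "(\<lambda>s. shock (snd s)) \<in> state_space \<rightarrow>\<^sub>M prob_algebra (\<nu> \<Otimes>\<^sub>M count_space UNIV)"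
    by (rule measurable_compose[OF measurable_snd])
       (auto simp: space_prob_algebra sets_shock prob_space_shock)
  have \<phi>m: "(\<lambda>(x, \<theta>). \<phi> x \<theta>) \<in> state_space \<rightarrow>\<^sub>M halfline"
    using \<phi>_meas \<phi>_nonneg by (intro measurable_restrict_space2) (auto simp: space_state_space)
  have 2: "(\<lambda>(s, q). next_state (snd s) (\<phi> (fst s) (snd s)) q) \<in> state_space \<Otimes>\<^sub>M (\<nu> \<Otimes>\<^sub>M count_space UNIV) \<rightarrow>\<^sub>M state_space"
    unfolding next_state_def split_beta'
  proof (rule measurable_Pair)
    let ?P = "state_space \<Otimes>\<^sub>M (\<nu> \<Otimes>\<^sub>M count_space UNIV)"
    have a: "(\<lambda>t. \<phi> (fst (fst t)) (snd (fst t))) \<in> ?P \<rightarrow>\<^sub>M halfline"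
      using measurable_compose[OF measurable_fst \<phi>m] by (simp add: split_beta')
    have b: "(\<lambda>t. fst (snd t)) \<in> ?P \<rightarrow>\<^sub>M \<nu>"
      by (rule measurable_compose[OF measurable_snd measurable_fst])
    have d: "(\<lambda>t. f \<theta> (\<phi> (fst (fst t)) (snd (fst t))) (fst (snd t))) \<in> ?P \<rightarrow>\<^sub>M halfline" for \<theta>
      using measurable_compose[OF measurable_Pair[OF a b] f_joint_meas[of \<theta>]] by simp
    show "(\<lambda>t. f (snd (fst t)) (\<phi> (fst (fst t)) (snd (fst t))) (fst (snd t))) \<in> ?P \<rightarrow>\<^sub>M halfline"
      by (rule measurable_compose_countable[where f="\<lambda>\<theta> t. f \<theta> (\<phi> (fst (fst t)) (snd (fst t))) (fst (snd t))" and g="\<lambda>t. snd (fst t)", OF d])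
         (rule measurable_compose[OF measurable_fst measurable_snd])
    show "(\<lambda>t. snd (snd t)) \<in> ?P \<rightarrow>\<^sub>M count_space UNIV"
      by (rule measurable_compose[OF measurable_snd measurable_snd])
  qed
  have "(\<lambda>s. distr (shock (snd s)) state_space (next_state (snd s) (\<phi> (fst s) (snd s)))) \<in> state_space \<rightarrow>\<^sub>M prob_algebra state_space"
    by (rule measurable_distr_prob_space2[OF 1 2])
  moreover have "(\<lambda>s. distr (shock (snd s)) state_space (next_state (snd s) (\<phi> (fst s) (snd s)))) = income_kernel p \<nu> f \<phi>"
  proof
    fix s :: "real \<times> 's"
    show "distr (shock (snd s)) state_space (next_state (snd s) (\<phi> (fst s) (snd s))) = income_kernel p \<nu> f \<phi> s"
      using income_kernel_eq[of "fst s" "snd s"] by simp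
  qed
  ultimately show ?thesis by simp
qed

lemma ex_nontrivial_stationary_distribution:
  "\<exists>\<mu>. stationary_distribution (income_kernel p \<nu> f \<phi>) \<mu> \<and> nontrivial_distribution \<mu>"
proof -
  obtain l K where l: "0 \<le> l" "l < 1" "0 \<le> K"
    and drift: "\<And>s. s \<in> space state_space \<Longrightarrow> integral\<^sup>N (income_kernel p \<nu> f \<phi> s) L \<le> ennreal l * L s + ennreal K"
    by (rule L_drift) blast
  have "\<exists>\<mu>. stationary_distribution (income_kernel p \<nu> f \<phi>) \<mu> \<and> emeasure \<mu> ({0} \<times> UNIV) = 0"
  proof (rule krylov_bogoliubov[OF income_kernel_meas income_kernel_feller L_meas drift l L_coercive])
    \<comment> \<open>Any state with positive income would do as a start, since \<open>W\<close> is
      finite there.\<close>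
    show "(1, undefined) \<in> space (state_space :: (real \<times> 's) measure)"
      by (simp add: space_state_space)
    show "L (1, undefined) < \<infinity>"
      by (simp add: L_def W_eq)
  qed
  then obtain \<mu> where \<mu>: "stationary_distribution (income_kernel p \<nu> f \<phi>) \<mu>" "emeasure \<mu> ({0} \<times> UNIV) = 0"
    by blast
  from \<mu>(2) have "nontrivial_distribution \<mu>"
    unfolding nontrivial_distribution_def measure_def by simp
  with \<mu>(1) show ?thesis by blast
qed

end

theorem theorem6p3:
  fixes p :: "'s::finite \<Rightarrow> 's \<Rightarrow> real"
    and \<nu> :: "real measure"
    and \<beta> \<gamma> :: real
    and u :: "real \<Rightarrow> real"
    and f :: "'s \<Rightarrow> real \<Rightarrow> real \<Rightarrow> real"
    and w V \<phi> :: "real \<Rightarrow> 's \<Rightarrow> real"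
  assumes p: "stochastic_matrix p"
    and \<nu>: "prob_space \<nu>" "sets \<nu> = sets halfline"
    and \<beta>: "0 < \<beta>" "\<beta> < 1"
    and \<gamma>: "0 < \<gamma>"
    and u_nonneg: "\<forall>a\<ge>0. 0 \<le> u a"
    and f_nonneg: "\<forall>\<theta>. \<forall>y\<ge>0. \<forall>z\<ge>0. 0 \<le> f \<theta> y z"
    and w: "\<forall>x\<ge>0. \<forall>\<theta>. 1 \<le> w x \<theta>"
           "\<forall>\<theta>. continuous_on {0..} (\<lambda>x. w x \<theta>)"
           "\<forall>\<theta>. mono_on {0..} (\<lambda>x. w x \<theta>)"
    and U1: "strictly_concave_on {0..} u" "strict_mono_on {0..} u"
            "continuous (at 0 within {0..}) u" "u 0 = 0"
    and U2: "\<exists>d>0. \<forall>\<theta>. \<forall>a\<ge>0. u a \<le> d * w a \<theta>"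
    and U3: "u C1_differentiable_on {0<..}"
    and U4: "filterlim (\<lambda>h. (u (0 + h) - u 0) / h) at_top (at_right 0)"
    and F1: "\<forall>\<theta>. \<forall>z\<ge>0. mono_on {0..} (\<lambda>y. f \<theta> y z) \<and>
               continuous_on {0..} (\<lambda>y. f \<theta> y z) \<and> concave_on {0..} (\<lambda>y. f \<theta> y z)"
            "\<forall>\<theta>. \<forall>y\<ge>0. f \<theta> y \<in> borel_measurable halfline"
    and F2: "\<exists>\<alpha>>0. \<alpha> < 1 / \<beta> \<and> (\<forall>\<theta>. \<forall>x\<ge>0.
               (SUP y\<in>{0..x}. SUP \<theta>'. \<integral>\<^sup>+ z. ennreal (w (f \<theta> y z) \<theta>') \<partial>\<nu>) \<le> ennreal (\<alpha> * w x \<theta>))"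
    and F3: "\<forall>\<theta>. \<forall>z\<ge>0. (\<lambda>y. f \<theta> y z) C1_differentiable_on {0<..}"
    and F4: "\<forall>\<theta>. \<forall>z\<ge>0. f \<theta> 0 z = 0"
    and F5: "AE z in \<nu>. \<exists>y>0. \<forall>\<theta>. 0 < deriv (\<lambda>y. f \<theta> y z) y"
    and D1: "\<exists>L<1. ((\<lambda>y. MAX \<theta>. \<integral>\<^sup>+ z. 1 / ennreal (\<beta> * deriv (\<lambda>y. f \<theta> y z) y) \<partial>\<nu>)
               \<longlongrightarrow> L) (at_right 0)"
    and D2: "\<exists>l2>0. l2 < 1 \<and> (\<exists>\<kappa>2>0. \<forall>y\<ge>0.
               (MAX \<theta>. \<integral>\<^sup>+ z. ennreal (f \<theta> y z) \<partial>\<nu>) \<le> ennreal (l2 * y + \<kappa>2))"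
    and D3: "irreducible_matrix p"
    and V: "is_value_function p \<nu> \<beta> \<gamma> u f w V"
    and \<phi>: "is_optimal_policy p \<nu> \<beta> \<gamma> u f V \<phi>"
  shows "\<exists>\<mu>. stationary_distribution (income_kernel p \<nu> f \<phi>) \<mu> \<and> nontrivial_distribution \<mu>"
proof -
  interpret growth_model p \<nu> \<beta> \<gamma> u f w V \<phi>
    by (rule growth_model.intro)
      (rule p \<nu> \<beta> \<gamma> f_nonneg[rule_format] U1 U3 U4
        F1(1)[rule_format, THEN conjunct1] F1(1)[rule_format, THEN conjunct2, THEN conjunct1]
        F1(1)[rule_format, THEN conjunct2, THEN conjunct2] F1(2)[rule_format]
        F3[rule_format] F4[rule_format] D1 D2 V \<phi> | assumption)+
  show ?thesis by (rule ex_nontrivial_stationary_distribution)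
qed

end
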